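(* For every real $p\ge1$ and integer $d\ge1$ there is a constant $c_{p,d}>0$ such that, for every integer $n\ge2$ and every estimator $\hat W$ (a measurable real-valued function of $n$ i.i.d. samples from $\mu$ and $n$ i.i.d. samples from $\nu$), there exists a pair of probability measures $\mu,\nu$ supported on $[0,1]^d$ such that $$\mathbb{E}\,|\hat W-W_p(\mu,\nu)|\;\ge\; r'_{p,d}(n),$$ where $r'_{p,d}(n)=c_{p,d}\,n^{-1/(2p)}$ if $d\le 2p$ and $r'_{p,d}(n)=c_{p,d}\,(n\log n)^{-1/d}$ if $d>2p$.
   Context: $W_p$ is the $p$-Wasserstein distance on $\mathbb{R}^d$ for the Euclidean norm. The samples from $\mu$ and from $\nu$ are independent of each other, and the expectation is with respect to these samples. *)

theory Defs
  imports "HOL-Probability.Probability"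
begin

definition unit_cube :: "(real ^ 'd) set" where
  "unit_cube = {x. \<forall>i. 0 \<le> x $ i \<and> x $ i \<le> 1}"

text \<open>Since the cube is closed, having full mass on it is the same as having topological
  support contained in it.\<close>

definition prob_measures_on :: "'a::topological_space set \<Rightarrow> 'a measure set" where
  "prob_measures_on S =
    {\<mu>. prob_space \<mu> \<and> sets \<mu> = sets borel \<and> measure \<mu> S = 1}"

definition couplings ::
  "'a::topological_space measure \<Rightarrow> 'a measure \<Rightarrow> ('a \<times> 'a) measure set" where
  "couplings \<mu> \<nu> =
    {\<pi>. sets \<pi> = sets (borel \<Otimes>\<^sub>M borel) \<and>
         distr \<pi> borel fst = \<mu> \<and> distr \<pi> borel snd = \<nu>}"

definition transport_cost ::
  "real \<Rightarrow> (real ^ 'd) measure \<Rightarrow> (real ^ 'd) measure \<Rightarrow> ennreal" where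
  "transport_cost p \<mu> \<nu> =
    (INF \<pi>\<in>couplings \<mu> \<nu>. \<integral>\<^sup>+ z. ennreal (norm (fst z - snd z) powr p) \<partial>\<pi>)"

text \<open>The norm on \<^typ>\<open>real ^ 'd\<close> is the Euclidean one. Converting to a real number
  sends an infinite transport cost to 0; this never happens for two probability measures on the
  unit cube, where the cost is at most the p-th power of the diameter.\<close>

definition wasserstein ::
  "real \<Rightarrow> (real ^ 'd) measure \<Rightarrow> (real ^ 'd) measure \<Rightarrow> real" where
  "wasserstein p \<mu> \<nu> = enn2real (transport_cost p \<mu> \<nu>) powr (1 / p)"

text \<open>An outcome is a pair (x, y), where x and y are indexed by \<^term>\<open>{..<n}\<close>: x is the sample
  from the first measure, y the sample from the second one. All 2n points are independent.\<close>

definition two_sample_law ::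
  "nat \<Rightarrow> 'a measure \<Rightarrow> 'a measure \<Rightarrow> ((nat \<Rightarrow> 'a) \<times> (nat \<Rightarrow> 'a)) measure" where
  "two_sample_law n \<mu> \<nu> = (\<Pi>\<^sub>M i\<in>{..<n}. \<mu>) \<Otimes>\<^sub>M (\<Pi>\<^sub>M i\<in>{..<n}. \<nu>)"

definition estimators ::
  "nat \<Rightarrow> ((nat \<Rightarrow> 'a::topological_space) \<times> (nat \<Rightarrow> 'a) \<Rightarrow> real) set" where
  "estimators n =
    borel_measurable ((\<Pi>\<^sub>M i\<in>{..<n}. borel) \<Otimes>\<^sub>M (\<Pi>\<^sub>M i\<in>{..<n}. borel))"

text \<open>The expected absolute error is a nonnegative integral, so that it is infinite (rather than 0)
  for estimators that are not integrable.\<close>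

definition wasserstein_risk ::
  "real \<Rightarrow> nat \<Rightarrow> ((nat \<Rightarrow> real ^ 'd) \<times> (nat \<Rightarrow> real ^ 'd) \<Rightarrow> real) \<Rightarrow>
    (real ^ 'd) measure \<Rightarrow> (real ^ 'd) measure \<Rightarrow> ennreal" where
  "wasserstein_risk p n W \<mu> \<nu> =
    (\<integral>\<^sup>+ z. ennreal \<bar>W z - wasserstein p \<mu> \<nu>\<bar> \<partial>two_sample_law n \<mu> \<nu>)"

definition lower_rate :: "real \<Rightarrow> real \<Rightarrow> nat \<Rightarrow> nat \<Rightarrow> real" where
  "lower_rate c p d n =
    (if real d \<le> 2 * p then c * real n powr (- 1 / (2 * p))
     else c * (real n * ln (real n)) powr (- 1 / real d))"

end

theory Submission
  imports Defs "HOL-Real_Asymp.Real_Asymp"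
begin

text \<open>
  Split the cube into m = q^d cells, put two points a(i), b(i) at distance 1 / (2q) into each
  cell, and let \<mu> have mass V(i) / (64m) at a(i) and 1 / (64m) at b(i), while \<nu> has these two
  masses exchanged; all remaining mass of both measures sits at one common point. Distinct points
  are at least 1 / (2q) apart, so the optimal plan moves mass only inside the cells and
  W(\<mu>, \<nu>) = (1 / (2q)) (\<Sum> |V(i) - 1| / (64m))^(1/p) exactly.

  For d > 2p, draw the V(i) independently from one of two laws whose first 2K - 1 moments agree
  but whose values of E |V - 1| differ by at least 1/4. Such laws live on [0, 16 K^2]: they are the
  even and the odd Chebyshev nodes, weighted by a kernel concentrated near 0. The law of the
  sample is a polynomial in each V(i), and its coefficients of degree at least 2K are so small that
  for m of order n K and K of order log n the two mixtures cannot be told apart; replacing the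
  V(i) one at a time shows this without Poissonization.

  For d \<le> 2p, and for small n, one cell suffices: V = 1 against V = 1 + \<epsilon> with \<epsilon> of order
  n^(-1/2), compared by the chi-square divergence.
\<close>

section \<open>Two distributions with matching moments\<close>

text \<open>The logarithm comes from polynomial approximation near an endpoint. On [0, 16 K^2] the
  kink of \<open>|V - 1|\<close> sits at the first node after 0, so by duality polynomials of degree
  below 2K miss it by a constant, while the mean of V stays bounded. A cell carries expected counts
  of order at most n K^2 / m, and degree 2K outweighs these once m >= 8 n K: a factor K more cells
  than samples.

  The common point pays for each V(i) without renormalisation. Hence every one-point mass is affine
  in each V(i), and the likelihood is a polynomial whose high coefficients can be bounded directly.
  The price is that a total mass above 1 must be excluded: one V(i) may reach 16 K^2, but its mean
  is at most 16, so with mass unit 1 / (64m) an overflow is exponentially unlikely.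

  Exchanging the coordinates singly multiplies the error by m, so the error of one exchange has to
  beat m; K >= ln n achieves this.\<close>

lemma sum_cos_roots_of_unity:
  fixes c :: int and n :: nat
  assumes "c \<noteq> 0" "\<bar>c\<bar> < int n"
  shows "(\<Sum>k<n. cos (2 * pi * of_int c * real k / real n)) = 0"
proof -
  \<comment> \<open>The cosine sum is the real part of a geometric series in an n-th root of unity;
    the bound on \<open>\<bar>c\<bar>\<close> excludes the root 1.\<close>
  define z where "z = cis (2 * pi * of_int c / real n)"
  have n: "real n > 0" using assms by auto
  have "z \<noteq> 1"
  proof
    assume "z = 1"
    then have "cos (2 * pi * of_int c / real n) = 1"
      by (simp add: z_def complex_eq_iff)
    then obtain j :: int where "2 * pi * of_int c / real n = of_int j * 2 * pi"
      unfolding cos_one_2pi_int by blast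
    then have "of_int c = real n * of_int j" using n by (simp add: field_simps)
    then have "c = int n * j" by (metis of_int_eq_iff of_int_mult of_int_of_nat_eq)
    then have "int n dvd c" by simp
    then have "\<bar>int n\<bar> \<le> \<bar>c\<bar>" using assms(1) by (rule dvd_imp_le_int[rotated])
    then show False using assms(2) by simp
  qed
  moreover have "z ^ n = 1"
  proof -
    have "z ^ n = cis (real n * (2 * pi * of_int c / real n))"
      unfolding z_def by (rule Complex.DeMoivre)
    also have "real n * (2 * pi * of_int c / real n) = 2 * pi * of_int c" using n by simp
    also have "cis (2 * pi * of_int c) = 1" by (simp add: cis_multiple_2pi)
    finally show ?thesis .
  qed
  ultimately have "(\<Sum>k<n. z ^ k) = 0" by (simp add: sum_gp_strict)
  then have "Re (\<Sum>k<n. z ^ k) = 0" by simp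
  moreover have "Re (\<Sum>k<n. z ^ k) = (\<Sum>k<n. cos (2 * pi * of_int c * real k / real n))"
    unfolding Re_sum z_def by (intro sum.cong refl) (simp add: Complex.DeMoivre mult_ac)
  ultimately show ?thesis by simp
qed

lemma cos_mult_one_minus_cos:
  fixes x :: real
  shows "cos (of_int c * x) * (1 - cos x)
    = cos (of_int c * x) - cos (of_int (c + 1) * x) / 2 - cos (of_int (c - 1) * x) / 2"
proof -
  have e: "of_int (c + 1) * x = of_int c * x + x" "of_int (c - 1) * x = of_int c * x - x"
    by (simp_all add: algebra_simps)
  show ?thesis unfolding e cos_add cos_diff by (simp add: field_simps)
qed

text \<open>At the nodes pi k / N the sign (-1)^k shifts the frequency by N. For j = 0 the shifted
  frequency c + N lies strictly between 0 and 2N, and the sum over the full circle vanishes. Each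
  factor 1 - cos widens the spectrum by one on either side, which the hypothesis budgets
  for.\<close>

lemma alternating_sum_cos_eq_0:
  fixes c :: int and N j :: nat
  assumes "\<bar>c\<bar> + int j < int N"
  shows "(\<Sum>k<2*N. (-1) ^ k * cos (of_int c * (pi * real k / real N)) * (1 - cos (pi * real k / real N)) ^ j) = 0"
  using assms
proof (induction j arbitrary: c)
  case 0
  have N: "real N > 0" using 0 by auto
  have "(\<Sum>k<2*N. (-1) ^ k * cos (of_int c * (pi * real k / real N)))
      = (\<Sum>k<2*N. cos (2 * pi * of_int (c + int N) * real k / real (2 * N)))"
  proof (intro sum.cong refl)
    fix k
    have e: "2 * pi * of_int (c + int N) * real k / real (2 * N) = of_int c * (pi * real k / real N) + pi * real k"
      using N by (simp add: field_simps)
    show "(-1) ^ k * cos (of_int c * (pi * real k / real N)) = cos (2 * pi * of_int (c + int N) * real k / real (2 * N))"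
      unfolding e cos_add by (simp add: mult.commute[of pi] cos_npi sin_npi)
  qed
  also have "\<dots> = 0" by (rule sum_cos_roots_of_unity) (use 0 in auto)
  finally show ?case by simp
next
  case (Suc j)
  let ?t = "\<lambda>k. pi * real k / real N"
  let ?S = "\<lambda>c. \<Sum>k<2*N. (-1) ^ k * cos (of_int c * ?t k) * (1 - cos (?t k)) ^ j"
  have "(\<Sum>k<2*N. (-1) ^ k * cos (of_int c * ?t k) * (1 - cos (?t k)) ^ Suc j)
     = (\<Sum>k<2*N. (-1) ^ k * (cos (of_int c * ?t k) * (1 - cos (?t k))) * (1 - cos (?t k)) ^ j)"
    by (simp add: mult_ac)
  also have "\<dots> = ?S c - ?S (c + 1) / 2 - ?S (c - 1) / 2"
    unfolding cos_mult_one_minus_cos sum_divide_distrib sum_subtractf[symmetric]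
    by (intro sum.cong refl) (simp add: algebra_simps)
  also have "\<dots> = 0" using Suc.prems by (subst (1 2 3) Suc.IH) auto
  finally show ?case .
qed

section \<open>Tent coefficients and the kernel they generate\<close>

definition tent :: "nat \<Rightarrow> nat \<Rightarrow> real" where
  "tent K a = real (min a (2 * K - a))"

lemma sum_lessThan_double:
  "(\<Sum>a<2*K. f a) = (\<Sum>a<K. f a + f (K + a :: nat) :: real)"
proof -
  have "{..<2*K} = {..<K} \<union> {K..<2*K}" by auto
  then have "(\<Sum>a<2*K. f a) = (\<Sum>a<K. f a) + (\<Sum>a=K..<2*K. f a)"
    by (simp add: sum.union_disjoint ivl_disj_int)
  also have "(\<Sum>a=K..<2*K. f a) = (\<Sum>a<K. f (K + a))"
    by (rule sum.reindex_bij_witness[of _ "\<lambda>a. K + a" "\<lambda>a. a - K"]) auto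
  finally show ?thesis by (simp add: sum.distrib)
qed

lemma sum_tent: "(\<Sum>a<2*K. tent K a) = real K ^ 2"
proof -
  have "(\<Sum>a<2*K. tent K a) = (\<Sum>a<K. real K)"
    unfolding sum_lessThan_double by (intro sum.cong refl) (auto simp: tent_def min_def of_nat_diff)
  then show ?thesis by (simp add: power2_eq_square)
qed

lemma sum_tent_sq:
  "real K ^ 3 / 2 \<le> (\<Sum>a<2*K. (tent K a)\<^sup>2)" "(\<Sum>a<2*K. (tent K a)\<^sup>2) \<le> real K ^ 3"
proof -
  have e: "(\<Sum>a<2*K. (tent K a)\<^sup>2) = (\<Sum>a<K. (real a)\<^sup>2 + (real K - real a)\<^sup>2)"
    unfolding sum_lessThan_double by (intro sum.cong refl) (auto simp: tent_def min_def of_nat_diff)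
  have c: "(\<Sum>a<K. (real K)\<^sup>2) = real K ^ 3" by (simp add: power2_eq_square power3_eq_cube)
  have "(\<Sum>a<K. (real a)\<^sup>2 + (real K - real a)\<^sup>2) \<le> (\<Sum>a<K. (real K)\<^sup>2)"
  proof (intro sum_mono)
    fix a assume "a \<in> {..<K}"
    then have "real a * (real K - real a) \<ge> 0" by simp
    then show "(real a)\<^sup>2 + (real K - real a)\<^sup>2 \<le> (real K)\<^sup>2"
      by (simp add: power2_eq_square algebra_simps)
  qed
  then show "(\<Sum>a<2*K. (tent K a)\<^sup>2) \<le> real K ^ 3" using e c by simp
  have "(\<Sum>a<K. (real K)\<^sup>2 / 2) \<le> (\<Sum>a<K. (real a)\<^sup>2 + (real K - real a)\<^sup>2)"
  proof (intro sum_mono)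
    fix a
    have "(2 * real a - real K)\<^sup>2 \<ge> 0" by simp
    then show "(real K)\<^sup>2 / 2 \<le> (real a)\<^sup>2 + (real K - real a)\<^sup>2"
      by (simp add: power2_eq_square algebra_simps)
  qed
  then show "real K ^ 3 / 2 \<le> (\<Sum>a<2*K. (tent K a)\<^sup>2)" using e c by (simp flip: sum_divide_distrib)
qed

text \<open>All squared increments of the tent are 1. Expanding their sum gives twice the left-hand
  side, since the tent vanishes at 0 and 2K and a shift thus preserves the sum of squares.\<close>

lemma sum_tent_shift:
  assumes "K > 0"
  shows "(\<Sum>a<2*K. (tent K a)\<^sup>2) - (\<Sum>a<2*K. tent K a * tent K (Suc a)) = real K"
proof -
  have "(\<Sum>a<2*K. (tent K (Suc a))\<^sup>2) = (\<Sum>a<2*K. (tent K a)\<^sup>2)"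
    using sum.lessThan_Suc_shift[of "\<lambda>a. (tent K a)\<^sup>2" "2*K"] by (simp add: tent_def)
  moreover have "(\<Sum>a<2*K. (tent K (Suc a) - tent K a)\<^sup>2) = (\<Sum>a<2*K. 1)"
  proof (intro sum.cong refl)
    fix a assume a: "a \<in> {..<2*K}"
    show "(tent K (Suc a) - tent K a)\<^sup>2 = 1"
    proof (cases "a < K")
      case True
      then have "tent K (Suc a) = real a + 1" "tent K a = real a"
        by (auto simp: tent_def min_def)
      then show ?thesis by simp
    next
      case False
      then have "tent K (Suc a) = 2 * real K - real a - 1" "tent K a = 2 * real K - real a"
        using a by (auto simp: tent_def min_def of_nat_diff)
      then show ?thesis by simp
    qed
  qed
  moreover have "(\<Sum>a<2*K. (tent K (Suc a) - tent K a)\<^sup>2) =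
    (\<Sum>a<2*K. (tent K (Suc a))\<^sup>2) + (\<Sum>a<2*K. (tent K a)\<^sup>2) - 2 * (\<Sum>a<2*K. tent K a * tent K (Suc a))"
    by (simp add: power2_diff sum.distrib sum_subtractf sum_distrib_left mult_ac)
  ultimately show ?thesis by simp
qed

text \<open>The range k < 8K runs once around the circle, so that discrete orthogonality is exact; k
  and 8K - k give the same cosine.\<close>

definition node :: "nat \<Rightarrow> nat \<Rightarrow> real" where
  "node K k = pi * real k / real (4 * K)"

text \<open>With p = tent K, this is |\<Sum> p(a) exp(i a \<theta>)|^2 at the k-th Chebyshev angle \<theta>. Smooth
  coefficients vanishing at both ends are needed: for constant p, the Fejer kernel, the mean of
  the rescaled variable would grow with K.\<close>

definition fejer :: "nat \<Rightarrow> nat \<Rightarrow> real" where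
  "fejer K k = (\<Sum>a<2*K. \<Sum>b<2*K. tent K a * tent K b * cos (of_int (int a - int b) * node K k))"

lemma fejer_eq:
  "fejer K k = (\<Sum>a<2*K. tent K a * cos (real a * node K k))\<^sup>2 + (\<Sum>a<2*K. tent K a * sin (real a * node K k))\<^sup>2"
proof -
  have "cos (of_int (int a - int b) * x) = cos (real a * x) * cos (real b * x) + sin (real a * x) * sin (real b * x)"
    for a b x by (simp add: left_diff_distrib cos_diff)
  then have "fejer K k = (\<Sum>a<2*K. \<Sum>b<2*K. (tent K a * cos (real a * node K k)) * (tent K b * cos (real b * node K k))
     + (tent K a * sin (real a * node K k)) * (tent K b * sin (real b * node K k)))"
    unfolding fejer_def by (intro sum.cong refl) (simp only: distrib_left mult_ac)
  then show ?thesis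
    unfolding power2_eq_square sum_product by (simp add: sum.distrib)
qed

lemma fejer_nonneg: "fejer K k \<ge> 0"
  unfolding fejer_eq by simp

lemma fejer_0: "fejer K 0 = real K ^ 4"
proof -
  have "fejer K 0 = (\<Sum>a<2*K. tent K a)\<^sup>2" unfolding fejer_eq by (simp add: node_def)
  then show ?thesis by (simp add: sum_tent)
qed

lemma sum_fejer_mult:
  "(\<Sum>k<n. g k * fejer K k) = (\<Sum>a<2*K. \<Sum>b<2*K. tent K a * tent K b * (\<Sum>k<n. g k * cos (of_int (int a - int b) * node K k)))"
proof -
  have "(\<Sum>k<n. g k * fejer K k) = (\<Sum>k<n. \<Sum>a<2*K. \<Sum>b<2*K. tent K a * tent K b * (g k * cos (of_int (int a - int b) * node K k)))"
    unfolding fejer_def sum_distrib_left by (intro sum.cong refl) (simp add: mult_ac)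
  also have "\<dots> = (\<Sum>a<2*K. \<Sum>k<n. \<Sum>b<2*K. tent K a * tent K b * (g k * cos (of_int (int a - int b) * node K k)))"
    by (rule sum.swap)
  also have "\<dots> = (\<Sum>a<2*K. \<Sum>b<2*K. \<Sum>k<n. tent K a * tent K b * (g k * cos (of_int (int a - int b) * node K k)))"
    by (intro sum.cong[OF refl]) (rule sum.swap)
  finally show ?thesis by (simp add: sum_distrib_left)
qed

text \<open>The kernel has frequencies up to 2K - 1 and the power adds at most 2K - 1 more; the
  total stays below 4K, the frequency of the alternating sign.\<close>

lemma fejer_alternating_moment:
  assumes "j < 2 * K"
  shows "(\<Sum>k<8*K. (-1) ^ k * fejer K k * (1 - cos (node K k)) ^ j) = 0"
proof -
  have "(\<Sum>k<8*K. ((-1) ^ k * (1 - cos (node K k)) ^ j) * fejer K k) = 0"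
    unfolding sum_fejer_mult
  proof (intro sum.neutral ballI)
    fix a b assume "a \<in> {..<2*K}" "b \<in> {..<2*K}"
    then have "\<bar>int a - int b\<bar> + int j < int (4 * K)" using assms by auto
    from alternating_sum_cos_eq_0[OF this]
    have "(\<Sum>k<8*K. (-1) ^ k * (1 - cos (node K k)) ^ j * cos (of_int (int a - int b) * node K k)) = 0"
      by (simp add: node_def mult_ac)
    then show "tent K a * tent K b * (\<Sum>k<8*K. (-1) ^ k * (1 - cos (node K k)) ^ j * cos (of_int (int a - int b) * node K k)) = 0"
      by simp
  qed
  then show ?thesis by (simp add: mult_ac)
qed

lemma sum_cos_node:
  assumes "\<bar>c\<bar> < int (8 * K)"
  shows "(\<Sum>k<8*K. cos (of_int c * node K k)) = (if c = 0 then 8 * real K else 0)"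
proof (cases "c = 0")
  case False
  have "(\<Sum>k<8*K. cos (of_int c * node K k)) = (\<Sum>k<8*K. cos (2 * pi * of_int c * real k / real (8 * K)))"
    by (intro sum.cong refl arg_cong[of _ _ cos]) (simp add: node_def field_simps)
  with sum_cos_roots_of_unity[OF False assms] False show ?thesis by simp
qed simp

text \<open>Discrete Parseval identity: the 8K nodes resolve all differences a - b, so only the
  diagonal survives.\<close>

lemma sum_fejer:
  "(\<Sum>k<8*K. fejer K k) = 8 * real K * (\<Sum>a<2*K. (tent K a)\<^sup>2)"
proof -
  have "(\<Sum>k<8*K. 1 * fejer K k) = (\<Sum>a<2*K. \<Sum>b<2*K. tent K a * tent K b * (if b = a then 8 * real K else 0))"
    unfolding sum_fejer_mult
  proof (rule sum.cong[OF refl], rule sum.cong[OF refl])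
    fix a b assume "a \<in> {..<2*K}" "b \<in> {..<2*K}"
    then show "tent K a * tent K b * (\<Sum>k<8*K. 1 * cos (of_int (int a - int b) * node K k)) = tent K a * tent K b * (if b = a then 8 * real K else 0)"
      unfolding mult_1 by (subst sum_cos_node) auto
  qed
  also have "\<dots> = (\<Sum>a<2*K. \<Sum>b<2*K. if b = a then tent K a * tent K b * (8 * real K) else 0)"
    by (intro sum.cong refl) auto
  also have "\<dots> = 8 * real K * (\<Sum>a<2*K. (tent K a)\<^sup>2)"
    by (simp add: sum_distrib_left power2_eq_square mult_ac)
  finally show ?thesis by simp
qed

text \<open>Multiplying by 1 - cos pairs the coefficients with their neighbours, so the sum is 8K
  times the quantity in \<open>sum_tent_shift\<close>. Being smaller than \<open>sum_fejer\<close>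
  by a factor of order K^2, it keeps the mean bounded after rescaling to [0, 16 K^2].\<close>

lemma sum_fejer_first_moment:
  assumes "K > 0"
  shows "(\<Sum>k<8*K. fejer K k * (1 - cos (node K k))) = 8 * real K ^ 2"
proof -
  let ?p = "tent K"
  have "(\<Sum>k<8*K. (1 - cos (node K k)) * fejer K k) = (\<Sum>a<2*K. \<Sum>b<2*K. ?p a * ?p b *
     (if b = a then 8 * real K else 0) - ?p a * ?p b * (if b = Suc a then 4 * real K else 0)
       - ?p a * ?p b * (if a = Suc b then 4 * real K else 0))"
    unfolding sum_fejer_mult
  proof (rule sum.cong[OF refl], rule sum.cong[OF refl])
    fix a b assume ab: "a \<in> {..<2*K}" "b \<in> {..<2*K}"
    let ?c = "int a - int b"
    have "(\<Sum>k<8*K. (1 - cos (node K k)) * cos (of_int ?c * node K k))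
      = (\<Sum>k<8*K. cos (of_int ?c * node K k)) - (\<Sum>k<8*K. cos (of_int (?c + 1) * node K k)) / 2
        - (\<Sum>k<8*K. cos (of_int (?c - 1) * node K k)) / 2"
      unfolding sum_divide_distrib sum_subtractf[symmetric]
      by (rule sum.cong[OF refl], rule trans[OF mult.commute], rule cos_mult_one_minus_cos)
    also have "\<dots> = (if ?c = 0 then 8 * real K else 0) - (if ?c + 1 = 0 then 8 * real K else 0) / 2
        - (if ?c - 1 = 0 then 8 * real K else 0) / 2"
      using ab by (intro arg_cong2[of _ _ _ _ "(-)"] arg_cong2[of _ _ _ _ "(/)"] sum_cos_node refl) auto
    also have "\<dots> = (if b = a then 8 * real K else 0) - (if b = Suc a then 4 * real K else 0)
       - (if a = Suc b then 4 * real K else 0)"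
      by auto
    finally show "?p a * ?p b * (\<Sum>k<8*K. (1 - cos (node K k)) * cos (of_int ?c * node K k)) =
      ?p a * ?p b * (if b = a then 8 * real K else 0) - ?p a * ?p b * (if b = Suc a then 4 * real K else 0)
       - ?p a * ?p b * (if a = Suc b then 4 * real K else 0)"
      by (simp add: right_diff_distrib)
  qed
  also have "\<dots> = (\<Sum>a<2*K. \<Sum>b<2*K. ?p a * ?p b * (if b = a then 8 * real K else 0))
     - (\<Sum>a<2*K. \<Sum>b<2*K. ?p a * ?p b * (if b = Suc a then 4 * real K else 0))
     - (\<Sum>a<2*K. \<Sum>b<2*K. ?p a * ?p b * (if a = Suc b then 4 * real K else 0))"
    by (simp add: sum_subtractf)
  also have "(\<Sum>a<2*K. \<Sum>b<2*K. ?p a * ?p b * (if a = Suc b then 4 * real K else 0))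
    = (\<Sum>a<2*K. \<Sum>b<2*K. ?p a * ?p b * (if b = Suc a then 4 * real K else 0))"
    by (subst sum.swap) (intro sum.cong refl, auto)
  also have "(\<Sum>a<2*K. \<Sum>b<2*K. ?p a * ?p b * (if b = Suc a then 4 * real K else 0))
    = (\<Sum>a<2*K. ?p a * ?p (Suc a) * (4 * real K))"
  proof (intro sum.cong refl)
    fix a assume a: "a \<in> {..<2*K}"
    have "(\<Sum>b<2*K. ?p a * ?p b * (if b = Suc a then 4 * real K else 0)) =
      (\<Sum>b<2*K. if b = Suc a then ?p a * ?p b * (4 * real K) else 0)"
      by (intro sum.cong refl) auto
    also have "\<dots> = (if Suc a < 2 * K then ?p a * ?p (Suc a) * (4 * real K) else 0)" by simp
    \<comment> \<open>For a = 2K - 1 the neighbour 2K is outside the range of b, but the tent is 0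
      there.\<close>
    also have "\<dots> = ?p a * ?p (Suc a) * (4 * real K)" using a by (auto simp: tent_def)
    finally show "(\<Sum>b<2*K. ?p a * ?p b * (if b = Suc a then 4 * real K else 0)) = ?p a * ?p (Suc a) * (4 * real K)" .
  qed
  also have "(\<Sum>a<2*K. \<Sum>b<2*K. ?p a * ?p b * (if b = a then 8 * real K else 0))
    = (\<Sum>a<2*K. \<Sum>b<2*K. if b = a then ?p a * ?p b * (8 * real K) else 0)"
    by (intro sum.cong refl) auto
  also have "\<dots> = (\<Sum>a<2*K. (?p a)\<^sup>2 * (8 * real K))" by (simp add: power2_eq_square)
  also have "(\<Sum>a<2*K. (?p a)\<^sup>2 * (8 * real K)) - (\<Sum>a<2*K. ?p a * ?p (Suc a) * (4 * real K))
     - (\<Sum>a<2*K. ?p a * ?p (Suc a) * (4 * real K))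
     = 8 * real K * ((\<Sum>a<2*K. (?p a)\<^sup>2) - (\<Sum>a<2*K. ?p a * ?p (Suc a)))"
    unfolding sum_distrib_right[symmetric] by (simp add: right_diff_distrib mult.commute)
  also have "\<dots> = 8 * real K ^ 2" using sum_tent_shift[OF assms] by (simp add: power2_eq_square)
  finally show ?thesis by (simp add: mult.commute)
qed

text \<open>Half-angle formula 1 - cos (2y) = 2 (sin y)^2 with y = pi / (8K). The cubic Taylor
  remainder gives sin y >= (23/24) y because y <= 1/2, and pi > 3 makes this at least 2 /
  (8K).\<close>

lemma one_minus_cos_ge:
  assumes "K > 0"
  shows "1 - cos (pi / real (4 * K)) \<ge> 1 / (8 * real K ^ 2)"
proof -
  define y where "y = pi / (8 * real K)"
  have y: "0 < y" "y \<le> 1/2" using assms pi_less_4 by (auto simp: y_def field_simps)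
  have "\<bar>sin y - (\<Sum>m<3. sin_coeff m * y ^ m)\<bar> \<le> inverse (fact 3) * \<bar>y\<bar> ^ 3"
    by (rule Maclaurin_sin_bound)
  also have "(\<Sum>m<3. sin_coeff m * y ^ m) = y" by (simp add: eval_nat_numeral sin_coeff_def)
  also have "inverse (fact 3) * \<bar>y\<bar> ^ 3 = y ^ 3 / 6" using y by (simp add: fact_numeral)
  finally have "sin y \<ge> y - y ^ 3 / 6" by linarith
  moreover have "y ^ 3 \<le> y * (1/4)"
  proof -
    have "y ^ 2 \<le> (1/2) ^ 2" using y by (intro power_mono) auto
    then have "y * y ^ 2 \<le> y * (1/4)" using y by (intro mult_left_mono) (auto simp: power2_eq_square)
    then show ?thesis by (simp add: power3_eq_cube power2_eq_square)
  qed
  ultimately have s: "sin y \<ge> y * (23/24)" by simp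
  have "y \<ge> 3 / (8 * real K)" using assms pi_gt3 by (auto simp: y_def intro!: divide_right_mono)
  then have "y * (23/24) \<ge> 3 / (8 * real K) * (23/24)" by (rule mult_right_mono) simp
  moreover have "3 / (8 * real K) * (23/24) \<ge> 2 / (8 * real K)" using assms by (simp add: field_simps)
  ultimately have "y * (23/24) \<ge> 2 / (8 * real K)" by linarith
  with s have "sin y \<ge> 2 / (8 * real K)" by simp
  then have "(sin y)\<^sup>2 \<ge> (2 / (8 * real K))\<^sup>2" by (intro power_mono) auto
  then have "2 * (sin y)\<^sup>2 \<ge> 1 / (8 * real K ^ 2)" using assms by (simp add: power2_eq_square field_simps)
  moreover have "cos (pi / real (4 * K)) = 1 - 2 * (sin y)\<^sup>2"
    using cos_double_sin[of y] by (simp add: y_def)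
  ultimately show ?thesis by simp
qed

text \<open>Angles beyond pi are reflected to 2 pi minus the angle. Node 1 is therefore a nearest
  neighbour of node 0 and can serve as the unit of length.\<close>

lemma cos_node_le:
  assumes "0 < k" "k < 8 * K"
  shows "cos (node K k) \<le> cos (pi / real (4 * K))"
proof (cases "k \<le> 4 * K")
  case True
  then show ?thesis using assms
    by (intro cos_monotone_0_pi_le) (auto simp: node_def field_simps)
next
  case False
  have "cos (node K k) = cos (2 * pi - node K k)" by simp
  also have "2 * pi - node K k = pi * (8 * real K - real k) / (4 * real K)"
    using assms by (simp add: node_def field_simps)
  also have "cos \<dots> \<le> cos (pi / real (4 * K))"
  proof (intro cos_monotone_0_pi_le)
    have "1 \<le> 8 * real K - real k" "8 * real K - real k \<le> 4 * real K" using assms False by linarith+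
    then show "pi / real (4 * K) \<le> pi * (8 * real K - real k) / (4 * real K)"
      "pi * (8 * real K - real k) / (4 * real K) \<le> pi"
      using assms by (auto simp: divide_right_mono pos_divide_le_eq)
  qed auto
  finally show ?thesis .
qed

text \<open>The values are 1 - cos divided by t, its value at node 1. This places the kink of
  \<open>|V - 1|\<close> at the first node after 0, and 2 / t <= 16 K^2 bounds the support. Matching
  moments are \<open>fejer_alternating_moment\<close> split into even and odd indices.\<close>

lemma moment_matching_weights:
  assumes "K > 0"
  obtains w w' V :: "nat \<Rightarrow> real" where
    "\<And>k. k < 8 * K \<Longrightarrow> 0 \<le> V k \<and> V k \<le> 16 * real K ^ 2"
    "\<And>k. w k \<ge> 0" "\<And>k. w' k \<ge> 0" "(\<Sum>k<8*K. w k) = 1" "(\<Sum>k<8*K. w' k) = 1"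
    "\<And>j. j < 2 * K \<Longrightarrow> (\<Sum>k<8*K. w k * V k ^ j) = (\<Sum>k<8*K. w' k * V k ^ j)"
    "(\<Sum>k<8*K. w k * V k) \<le> 16"
    "(\<Sum>k<8*K. w k * \<bar>V k - 1\<bar>) - (\<Sum>k<8*K. w' k * \<bar>V k - 1\<bar>) \<ge> 1/4"
proof -
  define Q where "Q = (\<Sum>a<2*K. (tent K a)\<^sup>2)"
  define t where "t = 1 - cos (pi / real (4 * K))"
  \<comment> \<open>Half of the total kernel mass: the moment of order 0 shows that even and odd
    indices have equal shares.\<close>
  define Z where "Z = 4 * real K * Q"
  define V where "V k = (1 - cos (node K k)) / t" for k
  define w where "w k = (if even k then fejer K k / Z else 0)" for k
  define w' where "w' k = (if odd k then fejer K k / Z else 0)" for k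
  have K: "real K \<ge> 1" using assms by simp
  have Q: "real K ^ 3 / 2 \<le> Q" "Q \<le> real K ^ 3" unfolding Q_def by (rule sum_tent_sq)+
  have Q0: "Q > 0" using Q(1) K by (smt (verit) divide_pos_pos zero_less_power)
  have Z0: "Z > 0" using Q0 K by (simp add: Z_def)
  have t: "t \<ge> 1 / (8 * real K ^ 2)" unfolding t_def by (rule one_minus_cos_ge) fact
  have t0: "t > 0" using t K by (smt (verit) divide_pos_pos zero_less_power)
  have it: "1 / t \<le> 8 * real K ^ 2" using t t0 K by (simp add: field_simps)
  have diff: "(\<Sum>k<8*K. w k * V k ^ j) - (\<Sum>k<8*K. w' k * V k ^ j) = 0" if "j < 2 * K" for j
  proof -
    have "(\<Sum>k<8*K. w k * V k ^ j) - (\<Sum>k<8*K. w' k * V k ^ j)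
      = (\<Sum>k<8*K. ((-1) ^ k * fejer K k * (1 - cos (node K k)) ^ j) / (Z * t ^ j))"
      unfolding sum_subtractf[symmetric]
      by (intro sum.cong refl) (auto simp: w_def w'_def V_def power_divide)
    also have "\<dots> = 0"
      unfolding sum_divide_distrib[symmetric] fejer_alternating_moment[OF that] by simp
    finally show ?thesis .
  qed
  have wsum: "w k + w' k = fejer K k / Z" for k by (auto simp: w_def w'_def)
  have tot: "(\<Sum>k<8*K. w k) + (\<Sum>k<8*K. w' k) = 2"
  proof -
    have "(\<Sum>k<8*K. w k) + (\<Sum>k<8*K. w' k) = (\<Sum>k<8*K. fejer K k) / Z"
      by (simp flip: sum.distrib add: wsum sum_divide_distrib)
    then show ?thesis unfolding sum_fejer Q_def[symmetric] using Q0 K by (simp add: Z_def)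
  qed
  have d0: "(\<Sum>k<8*K. w k) = (\<Sum>k<8*K. w' k)" using diff[of 0] assms by simp
  have d1: "(\<Sum>k<8*K. w k * V k) = (\<Sum>k<8*K. w' k * V k)" using diff[of 1] assms by simp
  show thesis
  proof (rule that[of V w w'])
    fix k assume "k < 8 * K"
    have "1 - cos (node K k) \<le> 2" using cos_ge_minus_one[of "node K k"] by linarith
    then have "V k \<le> 2 * (1 / t)" using t0 by (simp add: V_def divide_right_mono)
    also have "\<dots> \<le> 16 * real K ^ 2" using it by simp
    finally show "0 \<le> V k \<and> V k \<le> 16 * real K ^ 2" using t0 by (auto simp: V_def)
  next
    show "w k \<ge> 0" "w' k \<ge> 0" for k
      using fejer_nonneg[of K k] Z0 by (auto simp: w_def w'_def)
    show "(\<Sum>k<8*K. w k) = 1" "(\<Sum>k<8*K. w' k) = 1" using tot d0 by auto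
    show "(\<Sum>k<8*K. w k * V k ^ j) = (\<Sum>k<8*K. w' k * V k ^ j)" if "j < 2 * K" for j
      using diff[OF that] by simp
    have "2 * (\<Sum>k<8*K. w k * V k) = (\<Sum>k<8*K. w k * V k) + (\<Sum>k<8*K. w' k * V k)" using d1 by simp
    also have "\<dots> = (\<Sum>k<8*K. fejer K k / Z * V k)"
      by (simp flip: sum.distrib wsum add: distrib_right)
    also have "\<dots> = (\<Sum>k<8*K. fejer K k * (1 - cos (node K k))) / (Z * t)"
      by (simp add: sum_divide_distrib V_def)
    also have "\<dots> = 2 * real K / Q * (1 / t)"
      unfolding sum_fejer_first_moment[OF assms] using K by (simp add: Z_def power2_eq_square field_simps)
    also have "\<dots> \<le> 2 * real K / Q * (8 * real K ^ 2)" using it Q0 by (intro mult_left_mono) auto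
    also have "\<dots> \<le> 32" using Q(1) Q0 by (simp add: field_simps power2_eq_square power3_eq_cube)
    finally show "(\<Sum>k<8*K. w k * V k) \<le> 16" by simp
    \<comment> \<open>The kink is isolated in 2 max 0 (1 - V); the remaining linear part V - 1 has
      the same mean under both laws.\<close>
    have "(\<Sum>k<8*K. w k * \<bar>V k - 1\<bar>) - (\<Sum>k<8*K. w' k * \<bar>V k - 1\<bar>)
      = (\<Sum>k<8*K. (w k - w' k) * (2 * max 0 (1 - V k) + (V k - 1)))"
      unfolding sum_subtractf[symmetric] by (intro sum.cong refl) (auto simp: algebra_simps max_def)
    also have "\<dots> = (\<Sum>k<8*K. (w k - w' k) * (2 * max 0 (1 - V k))) + (\<Sum>k<8*K. (w k - w' k) * (V k - 1))"
      by (simp add: distrib_left sum.distrib)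
    also have "(\<Sum>k<8*K. (w k - w' k) * (V k - 1)) = 0"
      using d0 d1 by (simp add: algebra_simps sum.distrib sum_subtractf)
    \<comment> \<open>Only the node 0 lies below the threshold 1, because t was chosen as the next node.\<close>
    also have "(\<Sum>k<8*K. (w k - w' k) * (2 * max 0 (1 - V k)))
       = (\<Sum>k<8*K. if k = 0 then 2 * fejer K 0 / Z else 0)"
    proof (intro sum.cong refl)
      fix k assume "k \<in> {..<8*K}"
      then have k: "k < 8 * K" by simp
      show "(w k - w' k) * (2 * max 0 (1 - V k)) = (if k = 0 then 2 * fejer K 0 / Z else 0)"
      proof (cases "k = 0")
        case True
        then show ?thesis by (simp add: w_def w'_def V_def node_def)
      next
        case False
        then have "t \<le> 1 - cos (node K k)" using cos_node_le[of k K] k by (simp add: t_def)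
        then have "V k \<ge> 1" using t0 by (simp add: V_def)
        then show ?thesis using False by simp
      qed
    qed
    also have "\<dots> = 2 * fejer K 0 / Z" using assms by simp
    also have "2 * fejer K 0 / Z = real K ^ 3 / (2 * Q)" using K Q0
      by (simp add: fejer_0 Z_def field_simps eval_nat_numeral)
    also have "real K ^ 3 / (2 * Q) + 0 \<ge> 1/4" using Q Q0 by (simp add: field_simps)
    finally show "(\<Sum>k<8*K. w k * \<bar>V k - 1\<bar>) - (\<Sum>k<8*K. w' k * \<bar>V k - 1\<bar>) \<ge> 1/4" by simp
  qed
qed

section \<open>Product weights\<close>

text \<open>Expectation under independent coordinates. The weights may vary with the coordinate so
  that hybrids, with one law on some coordinates and another on the rest, are instances.\<close>

definition prod_expect :: "'i set \<Rightarrow> 'k set \<Rightarrow> ('i \<Rightarrow> 'k \<Rightarrow> real) \<Rightarrow> (('i \<Rightarrow> 'k) \<Rightarrow> real) \<Rightarrow> real" where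
  "prod_expect I D w F = (\<Sum>k\<in>I \<rightarrow>\<^sub>E D. (\<Prod>i\<in>I. w i (k i)) * F k)"

lemma prod_expect_cong:
  assumes "\<And>i x. i \<in> I \<Longrightarrow> x \<in> D \<Longrightarrow> w i x = w' i x"
  shows "prod_expect I D w F = prod_expect I D w' F"
  unfolding prod_expect_def using assms by (intro sum.cong refl) (auto simp: PiE_iff intro!: prod.cong)

lemma prod_expect_insert:
  assumes "finite I" "finite D" "i \<notin> I"
  shows "prod_expect (insert i I) D w F = prod_expect I D w (\<lambda>k. \<Sum>x\<in>D. w i x * F (k(i := x)))"
proof -
  have inj: "inj_on (\<lambda>(y, g). g(i := y)) (D \<times> (I \<rightarrow>\<^sub>E D))"
    using assms by (intro inj_combinator)
  have "prod_expect (insert i I) D w F = (\<Sum>(y, g)\<in>D \<times> (I \<rightarrow>\<^sub>E D). (\<Prod>j\<in>insert i I. w j ((g(i := y)) j)) * F (g(i := y)))"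
    unfolding prod_expect_def PiE_insert_eq sum.reindex[OF inj] by (simp add: case_prod_unfold)
  also have "\<dots> = (\<Sum>(y, g)\<in>D \<times> (I \<rightarrow>\<^sub>E D). (\<Prod>j\<in>I. w j (g j)) * (w i y * F (g(i := y))))"
  proof (intro sum.cong refl, clarify)
    fix y g
    have "(\<Prod>j\<in>I. w j ((g(i := y)) j)) = (\<Prod>j\<in>I. w j (g j))"
      using assms by (intro prod.cong) auto
    then show "(\<Prod>j\<in>insert i I. w j ((g(i := y)) j)) * F (g(i := y)) = (\<Prod>j\<in>I. w j (g j)) * (w i y * F (g(i := y)))"
      using assms by simp
  qed
  also have "\<dots> = prod_expect I D w (\<lambda>k. \<Sum>x\<in>D. w i x * F (k(i := x)))"
    unfolding prod_expect_def sum.cartesian_product[symmetric] sum_distrib_left by (rule sum.swap)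
  finally show ?thesis .
qed

lemma prod_expect_prod:
  assumes "finite I" "finite D"
  shows "prod_expect I D w (\<lambda>k. \<Prod>i\<in>I. g i (k i)) = (\<Prod>i\<in>I. \<Sum>x\<in>D. w i x * g i x)"
  unfolding prod_expect_def using assms by (simp add: prod_sum_PiE prod.distrib)

lemma prod_expect_const:
  assumes "finite I" "finite D" "\<And>i. i \<in> I \<Longrightarrow> (\<Sum>x\<in>D. w i x) = 1"
  shows "prod_expect I D w (\<lambda>_. c) = c"
proof -
  have "(\<Sum>k\<in>I \<rightarrow>\<^sub>E D. \<Prod>i\<in>I. w i (k i)) = 1"
    using assms by (simp flip: prod_sum_PiE)
  then show ?thesis unfolding prod_expect_def by (simp flip: sum_distrib_right)
qed

lemma prod_expect_mono:
  assumes "\<And>i x. i \<in> I \<Longrightarrow> x \<in> D \<Longrightarrow> 0 \<le> w i x" "\<And>k. k \<in> I \<rightarrow>\<^sub>E D \<Longrightarrow> F k \<le> G k"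
  shows "prod_expect I D w F \<le> prod_expect I D w G"
  unfolding prod_expect_def using assms
  by (intro sum_mono mult_left_mono prod_nonneg) (auto simp: PiE_iff)

lemma prod_expect_add: "prod_expect I D w (\<lambda>k. F k + G k) = prod_expect I D w F + prod_expect I D w G"
  by (simp add: prod_expect_def distrib_left sum.distrib)

lemma prod_expect_diff: "prod_expect I D w (\<lambda>k. F k - G k) = prod_expect I D w F - prod_expect I D w G"
  by (simp add: prod_expect_def right_diff_distrib sum_subtractf)

lemma prod_expect_cmult: "prod_expect I D w (\<lambda>k. c * F k) = c * prod_expect I D w F"
  by (simp add: prod_expect_def sum_distrib_left mult_ac)

lemma prod_expect_abs_le:
  assumes "\<And>i x. i \<in> I \<Longrightarrow> x \<in> D \<Longrightarrow> 0 \<le> w i x" "\<And>k. k \<in> I \<rightarrow>\<^sub>E D \<Longrightarrow> \<bar>F k\<bar> \<le> G k"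
  shows "\<bar>prod_expect I D w F\<bar> \<le> prod_expect I D w G"
proof -
  have "\<bar>prod_expect I D w F\<bar> \<le> prod_expect I D w (\<lambda>k. \<bar>F k\<bar>)"
    unfolding prod_expect_def using assms(1)
    by (intro order.trans[OF sum_abs] sum_mono) (auto simp: abs_mult PiE_iff intro!: mult_right_mono prod_nonneg)
  also have "\<dots> \<le> prod_expect I D w G" by (intro prod_expect_mono assms)
  finally show ?thesis .
qed

text \<open>The weights are exchanged one coordinate at a time. The product of the h-values is an
  exponential bound for the event that the other coordinates are too large for the comparison.\<close>

lemma prod_expect_hybrid:
  fixes w w' h :: "'k \<Rightarrow> real" and F :: "('i \<Rightarrow> 'k) \<Rightarrow> real"
  assumes fin: "finite I" "finite D"
    and w: "\<And>x. x \<in> D \<Longrightarrow> 0 \<le> w x" "\<And>x. x \<in> D \<Longrightarrow> 0 \<le> w' x"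
      "(\<Sum>x\<in>D. w x) = 1" "(\<Sum>x\<in>D. w' x) = 1"
    and h: "\<And>x. x \<in> D \<Longrightarrow> 0 \<le> h x" "(\<Sum>x\<in>D. w x * h x) \<le> H" "(\<Sum>x\<in>D. w' x * h x) \<le> H"
    and H: "1 \<le> H" and \<eta>: "0 \<le> \<eta>"
    and step: "\<And>i k. i \<in> I \<Longrightarrow> k \<in> (I - {i}) \<rightarrow>\<^sub>E D \<Longrightarrow>
       \<bar>\<Sum>x\<in>D. (w x - w' x) * F (k(i := x))\<bar> \<le> \<epsilon> + \<eta> * (\<Prod>j\<in>I - {i}. h (k j))"
  shows "\<bar>prod_expect I D (\<lambda>_. w) F - prod_expect I D (\<lambda>_. w') F\<bar> \<le> real (card I) * (\<epsilon> + \<eta> * H ^ card I)"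
proof -
  \<comment> \<open>Hybrid weights: coordinates in J already carry w, the others still carry
    w'.\<close>
  define W where "W J i = (if i \<in> J then w else w')" for J and i :: 'i
  have W: "0 \<le> W J i x" if "x \<in> D" for J i x using w that by (auto simp: W_def)
  have W1: "(\<Sum>x\<in>D. W J i x) = 1" for J i using w by (auto simp: W_def)
  have WH: "0 \<le> (\<Sum>x\<in>D. W J i x * h x)" "(\<Sum>x\<in>D. W J i x * h x) \<le> H" for J i
    using h W by (auto simp: W_def intro!: sum_nonneg mult_nonneg_nonneg w)
  have one: "\<bar>prod_expect I D (W (insert i J)) F - prod_expect I D (W J) F\<bar> \<le> \<epsilon> + \<eta> * H ^ card I"
    if i: "i \<in> I" "i \<notin> J" for i J
  proof -
    let ?I = "I - {i}"
    have split: "prod_expect I D W' F = prod_expect ?I D W' (\<lambda>k. \<Sum>x\<in>D. W' i x * F (k(i := x)))" for W'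
      using prod_expect_insert[of ?I D i W' F] fin i by (simp add: insert_absorb)
    \<comment> \<open>Away from i both hybrids have the same weights, so the difference is an
      average over the other coordinates of the one-coordinate difference in
      \<open>step\<close>.\<close>
    have "prod_expect I D (W (insert i J)) F = prod_expect ?I D (W J) (\<lambda>k. \<Sum>x\<in>D. w x * F (k(i := x)))"
      unfolding split by (subst prod_expect_cong[where w' = "W J"]) (auto simp: W_def)
    moreover have "prod_expect I D (W J) F = prod_expect ?I D (W J) (\<lambda>k. \<Sum>x\<in>D. w' x * F (k(i := x)))"
      unfolding split using i by (simp add: W_def)
    ultimately have "\<bar>prod_expect I D (W (insert i J)) F - prod_expect I D (W J) F\<bar>
       = \<bar>prod_expect ?I D (W J) (\<lambda>k. \<Sum>x\<in>D. (w x - w' x) * F (k(i := x)))\<bar>"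
      by (simp flip: prod_expect_diff add: sum_subtractf[symmetric] left_diff_distrib)
    also have "\<dots> \<le> prod_expect ?I D (W J) (\<lambda>k. \<epsilon> + \<eta> * (\<Prod>j\<in>?I. h (k j)))"
      by (intro prod_expect_abs_le W step i)
    also have "\<dots> = \<epsilon> + \<eta> * (\<Prod>j\<in>?I. \<Sum>x\<in>D. W J j x * h x)"
      using fin W1 prod_expect_prod[of ?I D "W J" "\<lambda>_. h"]
      by (simp add: prod_expect_add prod_expect_cmult prod_expect_const)
    also have "\<dots> \<le> \<epsilon> + \<eta> * H ^ card I"
    proof -
      have "(\<Prod>j\<in>?I. \<Sum>x\<in>D. W J j x * h x) \<le> (\<Prod>j\<in>?I. H)" by (intro prod_mono) (auto simp: WH)
      also have "\<dots> \<le> H ^ card I" using H fin by (simp add: power_increasing card_mono)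
      finally show ?thesis using \<eta> by (simp add: mult_left_mono)
    qed
    finally show ?thesis .
  qed
  have "\<bar>prod_expect I D (W J) F - prod_expect I D (W {}) F\<bar> \<le> real (card J) * (\<epsilon> + \<eta> * H ^ card I)" if "J \<subseteq> I" for J
    using finite_subset[OF that fin(1)] that
  proof (induction J rule: finite_induct)
    case (insert i J)
    then have "\<bar>prod_expect I D (W (insert i J)) F - prod_expect I D (W J) F\<bar> \<le> \<epsilon> + \<eta> * H ^ card I"
      by (intro one) auto
    moreover have "\<bar>prod_expect I D (W J) F - prod_expect I D (W {}) F\<bar> \<le> real (card J) * (\<epsilon> + \<eta> * H ^ card I)"
      using insert by auto
    ultimately show ?case using insert.hyps by (simp add: algebra_simps)
  qed simp
  from this[OF order_refl] show ?thesis
    by (subst (asm) (1) prod_expect_cong[where w' = "\<lambda>_. w"]; simp add: W_def[abs_def])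
qed

section \<open>Exponential moments of sums of independent coordinates\<close>

lemma exp_le_quadratic:
  fixes s :: real
  assumes "\<bar>s\<bar> \<le> 1"
  shows "exp s \<le> 1 + s + s\<^sup>2"
proof (cases "0 \<le> s")
  case True
  then show ?thesis using assms by (intro exp_bound) auto
next
  case False
  have "exp s * (1 - s) \<le> exp s * exp (- s)"
    using exp_ge_add_one_self[of "- s"] by (intro mult_left_mono) auto
  also have "\<dots> = 1" by (simp flip: exp_add)
  also have "1 \<le> (1 + s + s\<^sup>2) * (1 - s)"
  proof -
    have "s * s\<^sup>2 \<le> 0" using False by (intro mult_nonpos_nonneg) auto
    then show ?thesis by (simp add: algebra_simps power2_eq_square)
  qed
  finally show ?thesis using False by simp
qed

lemma exp_mult_le_chord:
  fixes s u :: real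
  assumes "0 \<le> u" "u \<le> 1"
  shows "exp (s * u) \<le> 1 + u * (exp s - 1)"
  using convex_onD[OF exp_convex, of u 0 s] assms by (simp add: algebra_simps)

text \<open>Bernstein-type bound. By convexity the exponential lies below its chord in f / B, so
  only the mean and the upper bound of f enter. This suits variables whose mean stays bounded while
  B grows like K^2. The quadratic bound on exp admits both signs of s, hence both tails.\<close>

lemma sum_exp_le:
  fixes w f :: "'k \<Rightarrow> real"
  assumes w: "\<And>x. x \<in> D \<Longrightarrow> 0 \<le> w x" "(\<Sum>x\<in>D. w x) = 1"
    and f: "\<And>x. x \<in> D \<Longrightarrow> 0 \<le> f x \<and> f x \<le> B" and B: "0 < B" and s: "\<bar>s\<bar> \<le> 1"
  shows "(\<Sum>x\<in>D. w x * exp (s * f x / B)) \<le> exp ((s + s\<^sup>2) * (\<Sum>x\<in>D. w x * f x) / B)"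
proof -
  have "(\<Sum>x\<in>D. w x * exp (s * f x / B)) \<le> (\<Sum>x\<in>D. w x * (1 + f x / B * (s + s\<^sup>2)))"
  proof (intro sum_mono mult_left_mono)
    fix x assume x: "x \<in> D"
    have "exp (s * (f x / B)) \<le> 1 + f x / B * (exp s - 1)"
      using f[OF x] B by (intro exp_mult_le_chord) auto
    also have "\<dots> \<le> 1 + f x / B * (s + s\<^sup>2)"
      using f[OF x] B exp_le_quadratic[OF s] by (intro add_left_mono mult_left_mono) auto
    finally show "exp (s * f x / B) \<le> 1 + f x / B * (s + s\<^sup>2)" by simp
  qed (use w in auto)
  also have "\<dots> = 1 + (s + s\<^sup>2) * (\<Sum>x\<in>D. w x * f x) / B"
  proof -
    have "(\<Sum>x\<in>D. w x * (1 + f x / B * (s + s\<^sup>2))) = (\<Sum>x\<in>D. w x + (s + s\<^sup>2) / B * (w x * f x))"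
      by (simp add: distrib_left add_divide_distrib mult_ac)
    also have "\<dots> = 1 + (s + s\<^sup>2) / B * (\<Sum>x\<in>D. w x * f x)"
      by (simp only: sum.distrib sum_distrib_left[symmetric] w(2))
    finally show ?thesis by simp
  qed
  also have "\<dots> \<le> exp ((s + s\<^sup>2) * (\<Sum>x\<in>D. w x * f x) / B)" by (rule exp_ge_add_one_self)
  finally show ?thesis .
qed

lemma prod_expect_exp_sum_le:
  fixes w f :: "'k \<Rightarrow> real"
  assumes fin: "finite I" "finite D"
    and w: "\<And>x. x \<in> D \<Longrightarrow> 0 \<le> w x" "(\<Sum>x\<in>D. w x) = 1"
    and f: "\<And>x. x \<in> D \<Longrightarrow> 0 \<le> f x \<and> f x \<le> B" and B: "0 < B" and s: "\<bar>s\<bar> \<le> 1"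
  shows "prod_expect I D (\<lambda>_. w) (\<lambda>k. exp (s * (\<Sum>i\<in>I. f (k i)) / B))
    \<le> exp (real (card I) * ((s + s\<^sup>2) * (\<Sum>x\<in>D. w x * f x) / B))"
proof -
  have "prod_expect I D (\<lambda>_. w) (\<lambda>k. exp (s * (\<Sum>i\<in>I. f (k i)) / B))
     = prod_expect I D (\<lambda>_. w) (\<lambda>k. \<Prod>i\<in>I. exp (s * f (k i) / B))"
    using fin by (simp add: exp_sum sum_distrib_left sum_divide_distrib)
  also have "\<dots> = (\<Sum>x\<in>D. w x * exp (s * f x / B)) ^ card I"
    using prod_expect_prod[OF fin, of "\<lambda>_. w" "\<lambda>_ x. exp (s * f x / B)"] by simp
  also have "\<dots> \<le> exp ((s + s\<^sup>2) * (\<Sum>x\<in>D. w x * f x) / B) ^ card I"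
    by (intro power_mono sum_exp_le assms sum_nonneg mult_nonneg_nonneg) auto
  finally show ?thesis by (simp flip: exp_of_nat_mult)
qed

section \<open>Expansion of the likelihood in a single mass parameter\<close>

definition mixed_coeff :: "nat set \<Rightarrow> ('a \<Rightarrow> real) \<Rightarrow> ('a \<Rightarrow> real) \<Rightarrow> nat set \<Rightarrow> (nat \<Rightarrow> 'a) \<Rightarrow> real" where
  "mixed_coeff I A B S x = (\<Prod>i\<in>I. if i \<in> S then B (x i) else A (x i))"

lemma prod_affine_expansion:
  assumes "finite I"
  shows "(\<Prod>i\<in>I. A (x i) + v * B (x i)) = (\<Sum>S\<in>Pow I. v ^ card S * mixed_coeff I A B S x)"
proof -
  have "(\<Prod>i\<in>I. A (x i) + v * B (x i)) = (\<Sum>S\<in>Pow I. (\<Prod>i\<in>S. v * B (x i)) * (\<Prod>i\<in>I - S. A (x i)))"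
    using prod_add[OF assms, of "\<lambda>i. v * B (x i)" "\<lambda>i. A (x i)"] by (simp add: add.commute)
  also have "\<dots> = (\<Sum>S\<in>Pow I. v ^ card S * mixed_coeff I A B S x)"
  proof (intro sum.cong refl)
    fix S assume "S \<in> Pow I"
    then have S: "S \<subseteq> I" by simp
    have "mixed_coeff I A B S x = (\<Prod>i\<in>S. B (x i)) * (\<Prod>i\<in>I - S. A (x i))"
      unfolding mixed_coeff_def prod.subset_diff[OF S assms]
      by (subst mult.commute, intro arg_cong2[of _ _ _ _ "(*)"] prod.cong) auto
    then show "(\<Prod>i\<in>S. v * B (x i)) * (\<Prod>i\<in>I - S. A (x i)) = v ^ card S * mixed_coeff I A B S x"
      by (simp add: prod.distrib)
  qed
  finally show ?thesis .
qed

text \<open>The coefficient factorises over the sample, so its l1 norm is a product: an index in S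
  contributes the l1 norm of the slope B, any other index the total mass 1 of A.\<close>

lemma sum_abs_mixed_coeff_le:
  fixes A B :: "'a \<Rightarrow> real"
  assumes "finite I" "finite P" "\<And>x. x \<in> P \<Longrightarrow> 0 \<le> A x" "(\<Sum>x\<in>P. A x) = 1" "(\<Sum>x\<in>P. \<bar>B x\<bar>) \<le> \<beta>" "S \<subseteq> I"
  shows "(\<Sum>x\<in>I \<rightarrow>\<^sub>E P. \<bar>mixed_coeff I A B S x\<bar>) \<le> \<beta> ^ card S"
proof -
  have "(\<Sum>x\<in>I \<rightarrow>\<^sub>E P. \<bar>mixed_coeff I A B S x\<bar>) = (\<Sum>x\<in>I \<rightarrow>\<^sub>E P. \<Prod>i\<in>I. if i \<in> S then \<bar>B (x i)\<bar> else A (x i))"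
    unfolding mixed_coeff_def abs_prod using assms by (intro sum.cong prod.cong refl) (auto simp: PiE_iff)
  also have "\<dots> = (\<Prod>i\<in>I. \<Sum>y\<in>P. if i \<in> S then \<bar>B y\<bar> else A y)"
    using assms by (simp add: prod_sum_PiE)
  also have "\<dots> = (\<Prod>i\<in>I. if i \<in> S then \<Sum>y\<in>P. \<bar>B y\<bar> else 1)"
    using assms by (intro prod.cong) auto
  also have "\<dots> = (\<Sum>y\<in>P. \<bar>B y\<bar>) ^ card S"
    using assms by (simp add: prod.If_cases Int_absorb1)
  also have "\<dots> \<le> \<beta> ^ card S" using assms by (intro power_mono sum_nonneg) auto
  finally show ?thesis .
qed

lemma sum_Pow_power:
  fixes t :: real
  assumes "finite I"
  shows "(\<Sum>S\<in>Pow I. t ^ card S) = (1 + t) ^ card I"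
  using prod_add[OF assms, of "\<lambda>_. t" "\<lambda>_. 1"] by (simp add: add.commute)

text \<open>Terms of degree j < L cancel by the matched moments. The others are multiplied by
  \<theta>^(j - L) >= 1, after which the sum can be extended to all pairs of subsets and becomes a
  binomial power. The free parameter \<theta> replaces an estimate of binomial tails.\<close>

lemma moment_matching_bound:
  fixes w w' V :: "'k \<Rightarrow> real" and c :: "nat set \<Rightarrow> nat set \<Rightarrow> real"
  assumes fin: "finite D" "finite I"
    and w: "\<And>x. x \<in> D \<Longrightarrow> 0 \<le> w x" "\<And>x. x \<in> D \<Longrightarrow> 0 \<le> w' x"
      "(\<Sum>x\<in>D. w x) = 1" "(\<Sum>x\<in>D. w' x) = 1"
    and V: "\<And>x. x \<in> D \<Longrightarrow> 0 \<le> V x \<and> V x \<le> R"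
    and mom: "\<And>j. j < L \<Longrightarrow> (\<Sum>x\<in>D. w x * V x ^ j) = (\<Sum>x\<in>D. w' x * V x ^ j)"
    and c: "\<And>S S'. S \<subseteq> I \<Longrightarrow> S' \<subseteq> I \<Longrightarrow> \<bar>c S S'\<bar> \<le> \<beta> ^ (card S + card S')"
    and pos: "1 \<le> \<theta>" "0 \<le> \<beta>" "0 \<le> R"
  shows "\<bar>\<Sum>x\<in>D. (w x - w' x) * (\<Sum>S\<in>Pow I. \<Sum>S'\<in>Pow I. V x ^ (card S + card S') * c S S')\<bar>
     \<le> (1 + \<theta> * \<beta> * R) ^ (2 * card I) / \<theta> ^ L"
proof -
  define \<Delta> where "\<Delta> j = (\<Sum>x\<in>D. (w x - w' x) * V x ^ j)" for j
  have D0: "\<Delta> j = 0" if "j < L" for j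
    using mom[OF that] by (simp add: \<Delta>_def left_diff_distrib sum_subtractf)
  have D1: "\<bar>\<Delta> j\<bar> \<le> R ^ j" for j
  proof -
    have b: "0 \<le> (\<Sum>x\<in>D. u x * V x ^ j) \<and> (\<Sum>x\<in>D. u x * V x ^ j) \<le> R ^ j"
      if u: "\<And>x. x \<in> D \<Longrightarrow> 0 \<le> u x" "(\<Sum>x\<in>D. u x) = 1" for u :: "'k \<Rightarrow> real"
    proof
      show "0 \<le> (\<Sum>x\<in>D. u x * V x ^ j)" using u V by (intro sum_nonneg) auto
      have "(\<Sum>x\<in>D. u x * V x ^ j) \<le> (\<Sum>x\<in>D. u x * R ^ j)"
        using u V by (intro sum_mono mult_left_mono power_mono) auto
      then show "(\<Sum>x\<in>D. u x * V x ^ j) \<le> R ^ j" using u by (simp flip: sum_distrib_right)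
    qed
    show ?thesis using b[OF w(1,3)] b[OF w(2,4)]
      by (auto simp: \<Delta>_def left_diff_distrib sum_subtractf)
  qed
  let ?t = "\<theta> * \<beta> * R"
  have summand: "\<bar>\<Delta> (card S + card S') * c S S'\<bar> \<le> ?t ^ card S * ?t ^ card S' / \<theta> ^ L" if "S \<subseteq> I" "S' \<subseteq> I" for S S'
  proof (cases "card S + card S' < L")
    case True
    then show ?thesis using D0 pos by simp
  next
    case False
    define j where "j = card S + card S'"
    have "\<bar>\<Delta> j * c S S'\<bar> \<le> R ^ j * \<beta> ^ j" unfolding abs_mult j_def
      using pos by (intro mult_mono D1 c that) auto
    also have "R ^ j * \<beta> ^ j = R ^ j * \<beta> ^ j * 1" by simp
    also have "\<dots> \<le> R ^ j * \<beta> ^ j * (\<theta> ^ j / \<theta> ^ L)"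
    proof (rule mult_left_mono)
      show "1 \<le> \<theta> ^ j / \<theta> ^ L" using False pos by (simp add: j_def power_increasing)
    qed (use pos in simp)
    also have "\<dots> = ?t ^ j / \<theta> ^ L" by (simp add: power_mult_distrib mult_ac)
    finally show ?thesis by (simp add: j_def power_add)
  qed
  have "(\<Sum>x\<in>D. (w x - w' x) * (\<Sum>S\<in>Pow I. \<Sum>S'\<in>Pow I. V x ^ (card S + card S') * c S S'))
      = (\<Sum>S\<in>Pow I. \<Sum>S'\<in>Pow I. \<Delta> (card S + card S') * c S S')"
    unfolding \<Delta>_def sum_distrib_left sum_distrib_right
    by (subst sum.swap, intro sum.cong refl, subst sum.swap) (simp add: mult_ac)
  also have "\<bar>\<dots>\<bar> \<le> (\<Sum>S\<in>Pow I. \<Sum>S'\<in>Pow I. ?t ^ card S * ?t ^ card S' / \<theta> ^ L)"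
    by (intro order.trans[OF sum_abs] sum_mono summand) auto
  also have "\<dots> = (\<Sum>S\<in>Pow I. ?t ^ card S) * (\<Sum>S\<in>Pow I. ?t ^ card S) / \<theta> ^ L"
    by (simp add: sum_product sum_divide_distrib)
  also have "\<dots> = (1 + ?t) ^ (2 * card I) / \<theta> ^ L"
    unfolding sum_Pow_power[OF fin(2)] by (simp add: mult_2 power_add)
  finally show ?thesis .
qed

text \<open>Expanding both likelihoods makes the expectation of T a polynomial in V k; S and S' mark
  the observations of the two samples that contribute their slope.\<close>

lemma two_sample_moment_bound:
  fixes w w' V :: "'k \<Rightarrow> real" and T :: "(nat \<Rightarrow> 'a) \<Rightarrow> (nat \<Rightarrow> 'a) \<Rightarrow> real"
  assumes fin: "finite D" "finite I" "finite P"
    and w: "\<And>x. x \<in> D \<Longrightarrow> 0 \<le> w x" "\<And>x. x \<in> D \<Longrightarrow> 0 \<le> w' x"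
      "(\<Sum>x\<in>D. w x) = 1" "(\<Sum>x\<in>D. w' x) = 1"
    and V: "\<And>x. x \<in> D \<Longrightarrow> 0 \<le> V x \<and> V x \<le> R"
    and mom: "\<And>j. j < L \<Longrightarrow> (\<Sum>x\<in>D. w x * V x ^ j) = (\<Sum>x\<in>D. w' x * V x ^ j)"
    and A: "\<And>x. x \<in> P \<Longrightarrow> 0 \<le> A x" "(\<Sum>x\<in>P. A x) = 1" "(\<Sum>x\<in>P. \<bar>B x\<bar>) \<le> \<beta>"
    and A': "\<And>x. x \<in> P \<Longrightarrow> 0 \<le> A' x" "(\<Sum>x\<in>P. A' x) = 1" "(\<Sum>x\<in>P. \<bar>B' x\<bar>) \<le> \<beta>"
    and T: "\<And>x y. \<bar>T x y\<bar> \<le> 1"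
    and pos: "1 \<le> \<theta>" "0 \<le> R"
  shows "\<bar>\<Sum>k\<in>D. (w k - w' k) * (\<Sum>x\<in>I \<rightarrow>\<^sub>E P. \<Sum>y\<in>I \<rightarrow>\<^sub>E P.
       (\<Prod>i\<in>I. A (x i) + V k * B (x i)) * (\<Prod>i\<in>I. A' (y i) + V k * B' (y i)) * T x y)\<bar>
     \<le> (1 + \<theta> * \<beta> * R) ^ (2 * card I) / \<theta> ^ L"
proof -
  define c where "c S S' = (\<Sum>x\<in>I \<rightarrow>\<^sub>E P. \<Sum>y\<in>I \<rightarrow>\<^sub>E P. mixed_coeff I A B S x * mixed_coeff I A' B' S' y * T x y)" for S S'
  have "0 \<le> (\<Sum>x\<in>P. \<bar>B x\<bar>)" by (intro sum_nonneg) auto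
  then have \<beta>: "0 \<le> \<beta>" using A(3) by linarith
  have c: "\<bar>c S S'\<bar> \<le> \<beta> ^ (card S + card S')" if S: "S \<subseteq> I" "S' \<subseteq> I" for S S'
  proof -
    have "\<bar>c S S'\<bar> \<le> (\<Sum>x\<in>I \<rightarrow>\<^sub>E P. \<Sum>y\<in>I \<rightarrow>\<^sub>E P. \<bar>mixed_coeff I A B S x * mixed_coeff I A' B' S' y * T x y\<bar>)"
      unfolding c_def by (rule order.trans[OF sum_abs], rule sum_mono, rule sum_abs)
    also have "\<dots> \<le> (\<Sum>x\<in>I \<rightarrow>\<^sub>E P. \<Sum>y\<in>I \<rightarrow>\<^sub>E P. \<bar>mixed_coeff I A B S x\<bar> * \<bar>mixed_coeff I A' B' S' y\<bar>)"
      unfolding abs_mult by (rule sum_mono, rule sum_mono, rule mult_left_le) (simp_all add: T)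
    also have "\<dots> = (\<Sum>x\<in>I \<rightarrow>\<^sub>E P. \<bar>mixed_coeff I A B S x\<bar>) * (\<Sum>y\<in>I \<rightarrow>\<^sub>E P. \<bar>mixed_coeff I A' B' S' y\<bar>)"
      by (simp add: sum_product)
    also have "\<dots> \<le> \<beta> ^ card S * \<beta> ^ card S'"
      using fin A A' S \<beta> by (intro mult_mono sum_abs_mixed_coeff_le sum_nonneg) auto
    finally show ?thesis by (simp add: power_add)
  qed
  have "(\<Sum>x\<in>I \<rightarrow>\<^sub>E P. \<Sum>y\<in>I \<rightarrow>\<^sub>E P. (\<Prod>i\<in>I. A (x i) + v * B (x i)) * (\<Prod>i\<in>I. A' (y i) + v * B' (y i)) * T x y)
     = (\<Sum>S\<in>Pow I. \<Sum>S'\<in>Pow I. v ^ (card S + card S') * c S S')" (is "?l = ?r") for v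
  proof -
    let ?f = "\<lambda>x y S S'. v ^ (card S + card S') * (mixed_coeff I A B S x * mixed_coeff I A' B' S' y * T x y)"
    let ?X = "I \<rightarrow>\<^sub>E P"
    have "?l = (\<Sum>x\<in>?X. \<Sum>y\<in>?X. \<Sum>S\<in>Pow I. \<Sum>S'\<in>Pow I. ?f x y S S')"
      unfolding prod_affine_expansion[OF fin(2)] sum_product unfolding sum_distrib_right
      by (intro sum.cong refl) (simp add: power_add mult_ac)
    also have "\<dots> = (\<Sum>x\<in>?X. \<Sum>S\<in>Pow I. \<Sum>y\<in>?X. \<Sum>S'\<in>Pow I. ?f x y S S')"
      by (rule sum.cong[OF refl], rule sum.swap)
    also have "\<dots> = (\<Sum>S\<in>Pow I. \<Sum>x\<in>?X. \<Sum>y\<in>?X. \<Sum>S'\<in>Pow I. ?f x y S S')"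
      by (rule sum.swap)
    also have "\<dots> = (\<Sum>S\<in>Pow I. \<Sum>x\<in>?X. \<Sum>S'\<in>Pow I. \<Sum>y\<in>?X. ?f x y S S')"
      by (rule sum.cong[OF refl], rule sum.cong[OF refl], rule sum.swap)
    also have "\<dots> = (\<Sum>S\<in>Pow I. \<Sum>S'\<in>Pow I. \<Sum>x\<in>?X. \<Sum>y\<in>?X. ?f x y S S')"
      by (rule sum.cong[OF refl], rule sum.swap)
    also have "\<dots> = ?r" unfolding c_def sum_distrib_left ..
    finally show ?thesis .
  qed
  then show ?thesis
    using moment_matching_bound[OF fin(1,2) w V mom c pos(1) \<beta> pos(2)] by simp
qed

section \<open>Paired cells\<close>

lemma nn_integral_finite_support:
  assumes "finite S" "AE z in M. z \<in> S" "\<And>z. z \<in> S \<Longrightarrow> {z} \<in> sets M"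
  shows "(\<integral>\<^sup>+z. f z \<partial>M) = (\<Sum>z\<in>S. f z * emeasure M {z})"
proof -
  have "(\<integral>\<^sup>+z. f z \<partial>M) = (\<integral>\<^sup>+z. (\<Sum>s\<in>S. f s * indicator {s} z) \<partial>M)"
  proof (intro nn_integral_cong_AE eventually_mono[OF assms(2)])
    fix z assume z: "z \<in> S"
    have "(\<Sum>s\<in>S. f s * indicator {s} z) = (\<Sum>s\<in>S. if s = z then f s else 0)"
      by (intro sum.cong) (auto simp: indicator_def)
    then show "f z = (\<Sum>s\<in>S. f s * indicator {s} z)" using z assms(1) by simp
  qed
  also have "\<dots> = (\<Sum>s\<in>S. \<integral>\<^sup>+z. f s * indicator {s} z \<partial>M)"
    using assms by (intro nn_integral_sum) auto
  also have "\<dots> = (\<Sum>z\<in>S. f z * emeasure M {z})"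
    using assms by (intro sum.cong refl nn_integral_cmult_indicator) auto
  finally show ?thesis .
qed

text \<open>The product law is concentrated on a finite grid, each of whose points is a box with
  singleton sides. This turns every risk into a finite sum.\<close>

lemma nn_integral_two_sample_law:
  fixes \<mu> \<nu> :: "'a::t1_space measure"
  assumes \<mu>: "prob_space \<mu>" "sets \<mu> = sets borel" "emeasure \<mu> P = 1"
    and \<nu>: "prob_space \<nu>" "sets \<nu> = sets borel" "emeasure \<nu> P = 1"
    and P: "finite P"
  shows "(\<integral>\<^sup>+z. f z \<partial>two_sample_law n \<mu> \<nu>) =
    (\<Sum>x\<in>{..<n} \<rightarrow>\<^sub>E P. \<Sum>y\<in>{..<n} \<rightarrow>\<^sub>E P.
      ennreal ((\<Prod>i<n. measure \<mu> {x i}) * (\<Prod>i<n. measure \<nu> {y i})) * f (x, y))"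
proof -
  let ?I = "{..<n}"
  let ?X = "?I \<rightarrow>\<^sub>E P"
  interpret M: prob_space \<mu> by fact
  interpret N: prob_space \<nu> by fact
  interpret PM: product_prob_space "\<lambda>_. \<mu>" ?I by unfold_locales
  interpret PN: product_prob_space "\<lambda>_. \<nu>" ?I by unfold_locales
  interpret SM: prob_space "PiM ?I (\<lambda>_. \<mu>)" by (rule PM.prob_space_axioms)
  interpret SN: prob_space "PiM ?I (\<lambda>_. \<nu>)" by (rule PN.prob_space_axioms)
  have times: "emeasure (PiM ?I (\<lambda>_. \<mu>) \<Otimes>\<^sub>M PiM ?I (\<lambda>_. \<nu>)) (A \<times> B) =
      emeasure (PiM ?I (\<lambda>_. \<mu>)) A * emeasure (PiM ?I (\<lambda>_. \<nu>)) B"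
    if "A \<in> sets (PiM ?I (\<lambda>_. \<mu>))" "B \<in> sets (PiM ?I (\<lambda>_. \<nu>))" for A B
    using that by (intro sigma_finite_measure.emeasure_pair_measure_Times prob_space_imp_sigma_finite
      PN.prob_space_axioms)
  interpret PP: pair_prob_space "PiM ?I (\<lambda>_. \<mu>)" "PiM ?I (\<lambda>_. \<nu>)" ..
  have fin: "A \<in> sets borel" if "A \<subseteq> P" for A :: "'a set"
    using finite_subset[OF that P] by (simp add: finite_imp_closed)
  have boxM: "PiE ?I A \<in> sets (PiM ?I (\<lambda>_. \<mu>))" "emeasure (PiM ?I (\<lambda>_. \<mu>)) (PiE ?I A) = (\<Prod>i<n. emeasure \<mu> (A i))"
    if "\<And>i. i < n \<Longrightarrow> A i \<subseteq> P" for A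
    using that fin \<mu>(2) by (auto intro!: sets_PiM_I_finite PM.emeasure_PiM)
  have boxN: "PiE ?I A \<in> sets (PiM ?I (\<lambda>_. \<nu>))" "emeasure (PiM ?I (\<lambda>_. \<nu>)) (PiE ?I A) = (\<Prod>i<n. emeasure \<nu> (A i))"
    if "\<And>i. i < n \<Longrightarrow> A i \<subseteq> P" for A
    using that fin \<nu>(2) by (auto intro!: sets_PiM_I_finite PN.emeasure_PiM)
  have single: "{x} = PiE ?I (\<lambda>i. {x i})" if "x \<in> ?X" for x
    using PiE_singleton[of x ?I] that by (auto simp: PiE_iff)
  have sub: "{x i} \<subseteq> P" if "x \<in> ?X" "i < n" for x i using that by auto
  have sM: "{x} \<in> sets (PiM ?I (\<lambda>_. \<mu>))" "emeasure (PiM ?I (\<lambda>_. \<mu>)) {x} = (\<Prod>i<n. emeasure \<mu> {x i})" if "x \<in> ?X" for x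
    using boxM[of "\<lambda>i. {x i}"] sub[OF that] unfolding single[OF that] by blast+
  have sN: "{x} \<in> sets (PiM ?I (\<lambda>_. \<nu>))" "emeasure (PiM ?I (\<lambda>_. \<nu>)) {x} = (\<Prod>i<n. emeasure \<nu> {x i})" if "x \<in> ?X" for x
    using boxN[of "\<lambda>i. {x i}"] sub[OF that] unfolding single[OF that] by blast+
  have one: "emeasure (two_sample_law n \<mu> \<nu>) (?X \<times> ?X) = 1"
    unfolding two_sample_law_def
    using boxM[of "\<lambda>_. P"] boxN[of "\<lambda>_. P"] \<mu>(3) \<nu>(3)
    by (subst times) auto
  have meas: "?X \<times> ?X \<in> sets (two_sample_law n \<mu> \<nu>)"
    unfolding two_sample_law_def using boxM[of "\<lambda>_. P"] boxN[of "\<lambda>_. P"] by auto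
  interpret T: prob_space "two_sample_law n \<mu> \<nu>"
    unfolding two_sample_law_def by (rule prob_space_pair) unfold_locales
  have AE: "AE z in two_sample_law n \<mu> \<nu>. z \<in> ?X \<times> ?X"
    using one meas by (subst T.AE_in_set_eq_1) (auto simp: T.emeasure_eq_measure)
  have pair: "{(x, y)} \<in> sets (two_sample_law n \<mu> \<nu>) \<and> emeasure (two_sample_law n \<mu> \<nu>) {(x, y)} =
      ennreal ((\<Prod>i<n. measure \<mu> {x i}) * (\<Prod>i<n. measure \<nu> {y i}))" if "x \<in> ?X" "y \<in> ?X" for x y
  proof -
    have e: "{(x, y)} = {x} \<times> {y}" by auto
    have "emeasure (two_sample_law n \<mu> \<nu>) {(x, y)} = (\<Prod>i<n. emeasure \<mu> {x i}) * (\<Prod>i<n. emeasure \<nu> {y i})"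
      unfolding two_sample_law_def e using sM[OF that(1)] sN[OF that(2)]
      by (subst times) auto
    moreover have "{(x, y)} \<in> sets (two_sample_law n \<mu> \<nu>)"
      unfolding two_sample_law_def e using sM[OF that(1)] sN[OF that(2)] by (intro pair_measureI)
    ultimately show ?thesis
      by (auto simp: M.emeasure_eq_measure N.emeasure_eq_measure prod_ennreal prod_nonneg ennreal_mult)
  qed
  have "(\<integral>\<^sup>+z. f z \<partial>two_sample_law n \<mu> \<nu>) = (\<Sum>z\<in>?X \<times> ?X. f z * emeasure (two_sample_law n \<mu> \<nu>) {z})"
    using AE P pair by (intro nn_integral_finite_support) (auto intro!: finite_PiE)
  also have "\<dots> = (\<Sum>(x, y)\<in>?X \<times> ?X. ennreal ((\<Prod>i<n. measure \<mu> {x i}) * (\<Prod>i<n. measure \<nu> {y i})) * f (x, y))"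
    using pair by (intro sum.cong refl) (auto simp: mult.commute)
  finally show ?thesis by (simp add: sum.cartesian_product)
qed

lemma unit_cube_eq: "unit_cube = cbox (0 :: real ^ 'd) 1"
  by (auto simp: unit_cube_def mem_box_cart)

lemma sum_insert_None_Some:
  fixes f :: "('c \<times> bool \<times> bool) option \<Rightarrow> 'b::comm_monoid_add"
  assumes "finite C"
  shows "(\<Sum>j\<in>insert None (Some ` (C \<times> UNIV)). f j) =
    f None + (\<Sum>i\<in>C. f (Some (i, True, True)) + f (Some (i, False, False)) + (f (Some (i, True, False)) + f (Some (i, False, True))))"
proof -
  have "(\<Sum>j\<in>insert None (Some ` (C \<times> UNIV)). f j) = f None + (\<Sum>j\<in>Some ` (C \<times> UNIV). f j)"
    using assms by (subst sum.insert) auto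
  also have "(\<Sum>j\<in>Some ` (C \<times> UNIV). f j) = (\<Sum>i\<in>C. \<Sum>st\<in>UNIV. f (Some (i, st)))"
    by (simp add: sum.reindex sum.cartesian_product case_prod_unfold)
  also have "\<dots> = (\<Sum>i\<in>C. f (Some (i, True, True)) + f (Some (i, False, False)) + (f (Some (i, True, False)) + f (Some (i, False, True))))"
    by (intro sum.cong refl) (simp add: UNIV_Times_UNIV[symmetric] sum.cartesian_product[symmetric] UNIV_bool add_ac del: UNIV_Times_UNIV)
  finally show ?thesis .
qed

section \<open>The pair of measures, its exact transport cost and its risk\<close>

locale paired_cells =
  fixes C :: "'c set" and a b :: "'c \<Rightarrow> real ^ 'd" and z :: "real ^ 'd" and \<delta> \<kappa> :: real
  assumes finite_C: "finite C" and delta_pos: "0 < \<delta>" and kappa_pos: "0 < \<kappa>"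
    and inj: "inj_on a C" "inj_on b C"
    and distinct_points: "\<And>i j. i \<in> C \<Longrightarrow> j \<in> C \<Longrightarrow> a i \<noteq> b j"
      "\<And>i. i \<in> C \<Longrightarrow> a i \<noteq> z" "\<And>i. i \<in> C \<Longrightarrow> b i \<noteq> z"
    and dist_pair: "\<And>i. i \<in> C \<Longrightarrow> norm (a i - b i) = \<delta>"
    and separated: "\<And>x y. x \<in> insert z (a ` C \<union> b ` C) \<Longrightarrow> y \<in> insert z (a ` C \<union> b ` C) \<Longrightarrow> x \<noteq> y
       \<Longrightarrow> \<delta> \<le> norm (x - y)"
    and in_cube: "insert z (a ` C \<union> b ` C) \<subseteq> unit_cube"
begin

definition points :: "(real ^ 'd) set" where
  "points = insert z (a ` C \<union> b ` C)"

text \<open>The second clause keeps the remainder at \<open>z\<close> nonnegative.\<close>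

definition admissible :: "('c \<Rightarrow> real) \<Rightarrow> bool" where
  "admissible V \<longleftrightarrow> (\<forall>i\<in>C. 0 \<le> V i) \<and> \<kappa> * (\<Sum>i\<in>C. 1 + V i) \<le> 1"

text \<open>The arguments u and v let one formula serve both marginals: \<open>mass a b\<close> is
  the first law and \<open>mass b a\<close> the second. The remainder at \<open>z\<close> absorbs
  the normalisation.\<close>

definition mass :: "('c \<Rightarrow> real ^ 'd) \<Rightarrow> ('c \<Rightarrow> real ^ 'd) \<Rightarrow> ('c \<Rightarrow> real) \<Rightarrow> (real ^ 'd) set \<Rightarrow> real" where
  "mass u v V A = (1 - \<kappa> * (\<Sum>i\<in>C. 1 + V i)) * indicator A z
     + \<kappa> * (\<Sum>i\<in>C. V i * indicator A (u i) + indicator A (v i))"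

text \<open>\<open>None\<close> is the mass resting at \<open>z\<close>. In
  \<open>Some (i, s, t)\<close> the flags s and t name source and target within cell i,
  \<open>True\<close> standing for a i and \<open>False\<close> for b i.\<close>

definition plan_index :: "('c \<times> bool \<times> bool) option set" where
  "plan_index = insert None (Some ` (C \<times> UNIV))"

text \<open>In each cell min (V i) 1 stays at either point and only the imbalance moves, from a i to
  b i if V i > 1 and back otherwise. In units of \<kappa>, the row sums are V i and 1, the column
  sums 1 and V i.\<close>

fun plan_weight :: "('c \<Rightarrow> real) \<Rightarrow> ('c \<times> bool \<times> bool) option \<Rightarrow> real" where
  "plan_weight V None = 1 - \<kappa> * (\<Sum>i\<in>C. 1 + V i)"
| "plan_weight V (Some (i, s, t)) =
    \<kappa> * (if s = t then min (V i) 1 else if s then max 0 (V i - 1) else max 0 (1 - V i))"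

fun plan_points :: "('c \<times> bool \<times> bool) option \<Rightarrow> (real ^ 'd) \<times> (real ^ 'd)" where
  "plan_points None = (z, z)"
| "plan_points (Some (i, s, t)) = (if s then a i else b i, if t then a i else b i)"

definition plan :: "('c \<Rightarrow> real) \<Rightarrow> ((real ^ 'd) \<times> (real ^ 'd)) measure" where
  "plan V = distr (point_measure plan_index (\<lambda>j. ennreal (plan_weight V j))) (borel \<Otimes>\<^sub>M borel) plan_points"

text \<open>With both laws defined as marginals of the plan, the coupling property holds by
  construction; their explicit masses are computed afterwards.\<close>

definition first_law :: "('c \<Rightarrow> real) \<Rightarrow> (real ^ 'd) measure" where
  "first_law V = distr (plan V) borel fst"

definition second_law :: "('c \<Rightarrow> real) \<Rightarrow> (real ^ 'd) measure" where
  "second_law V = distr (plan V) borel snd"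

lemma finite_points: "finite points" using finite_C by (simp add: points_def)

lemma finite_plan_index: "finite plan_index" using finite_C by (simp add: plan_index_def)

lemma sets_plan [simp]: "sets (plan V) = sets (borel \<Otimes>\<^sub>M borel)" by (simp add: plan_def)

lemma sets_laws [simp]: "sets (first_law V) = sets borel" "sets (second_law V) = sets borel"
  by (simp_all add: first_law_def second_law_def)

lemma plan_in_couplings: "plan V \<in> couplings (first_law V) (second_law V)"
  by (simp add: couplings_def first_law_def second_law_def)

lemma plan_weight_nonneg:
  assumes "admissible V" "j \<in> plan_index"
  shows "0 \<le> plan_weight V j"
  using assms kappa_pos by (cases "(V, j)" rule: plan_weight.cases) (auto simp: admissible_def plan_index_def)

lemma measurable_plan_points: "plan_points \<in> point_measure plan_index f \<rightarrow>\<^sub>M borel \<Otimes>\<^sub>M borel"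
  using finite_plan_index by (simp add: space_pair_measure)

lemma nn_integral_plan:
  assumes V: "admissible V" and f: "f \<in> borel_measurable (borel \<Otimes>\<^sub>M borel)" "\<And>x. 0 \<le> f x"
  shows "(\<integral>\<^sup>+x. ennreal (f x) \<partial>plan V) = ennreal (\<Sum>j\<in>plan_index. plan_weight V j * f (plan_points j))"
proof -
  have "(\<integral>\<^sup>+x. ennreal (f x) \<partial>plan V) =
     (\<integral>\<^sup>+j. ennreal (f (plan_points j)) \<partial>point_measure plan_index (\<lambda>j. ennreal (plan_weight V j)))"
    unfolding plan_def using f by (intro nn_integral_distr measurable_plan_points) simp
  also have "\<dots> = (\<Sum>j\<in>plan_index. ennreal (f (plan_points j)) * ennreal (plan_weight V j))"
    by (subst nn_integral_point_measure_finite) (auto simp: finite_plan_index mult.commute)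
  also have "\<dots> = (\<Sum>j\<in>plan_index. ennreal (plan_weight V j * f (plan_points j)))"
    using f plan_weight_nonneg[OF V] by (intro sum.cong refl) (simp add: ennreal_mult'' mult.commute)
  also have "\<dots> = ennreal (\<Sum>j\<in>plan_index. plan_weight V j * f (plan_points j))"
    using f plan_weight_nonneg[OF V] by (intro sum_ennreal) auto
  finally show ?thesis .
qed

lemma emeasure_plan:
  assumes "admissible V" "A \<in> sets (borel \<Otimes>\<^sub>M borel)"
  shows "emeasure (plan V) A = ennreal (\<Sum>j\<in>plan_index. plan_weight V j * indicator A (plan_points j))"
proof -
  have "emeasure (plan V) A = (\<integral>\<^sup>+x. ennreal (indicator A x) \<partial>plan V)"
    using assms by (subst nn_integral_indicator[symmetric]) (auto simp: ennreal_indicator)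
  then show ?thesis using assms by (simp add: nn_integral_plan)
qed

lemma sum_plan_index:
  "(\<Sum>j\<in>plan_index. plan_weight V j * f (plan_points j)) = (1 - \<kappa> * (\<Sum>i\<in>C. 1 + V i)) * f (z, z)
    + \<kappa> * (\<Sum>i\<in>C. min (V i) 1 * (f (a i, a i) + f (b i, b i)) + (max 0 (V i - 1) * f (a i, b i) + max 0 (1 - V i) * f (b i, a i)))"
proof -
  have "(\<Sum>j\<in>plan_index. plan_weight V j * f (plan_points j)) = (1 - \<kappa> * (\<Sum>i\<in>C. 1 + V i)) * f (z, z)
    + (\<Sum>i\<in>C. \<kappa> * (min (V i) 1 * (f (a i, a i) + f (b i, b i)) + (max 0 (V i - 1) * f (a i, b i) + max 0 (1 - V i) * f (b i, a i))))"
    unfolding plan_index_def sum_insert_None_Some[OF finite_C]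
    by (intro arg_cong2[of _ _ _ _ "(+)"] sum.cong refl) (simp_all add: distrib_left mult.assoc)
  then show ?thesis by (simp only: sum_distrib_left)
qed

lemma emeasure_first_law:
  assumes "admissible V" "A \<in> sets borel"
  shows "emeasure (first_law V) A = ennreal (mass a b V A)"
proof -
  have "emeasure (first_law V) A = emeasure (plan V) (A \<times> UNIV)"
    unfolding first_law_def using assms
    by (subst emeasure_distr) (auto simp: plan_def space_pair_measure intro!: arg_cong2[of _ _ _ _ emeasure])
  also have "\<dots> = ennreal (\<Sum>j\<in>plan_index. plan_weight V j * indicator A (fst (plan_points j)))"
    using assms by (subst emeasure_plan) (auto simp: indicator_times)
  also have "(\<Sum>j\<in>plan_index. plan_weight V j * indicator A (fst (plan_points j))) = mass a b V A"
  proof -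
    have "(\<Sum>i\<in>C. min (V i) 1 * (indicator A (fst (a i, a i)) + indicator A (fst (b i, b i)))
        + (max 0 (V i - 1) * indicator A (fst (a i, b i)) + max 0 (1 - V i) * indicator A (fst (b i, a i))))
      = (\<Sum>i\<in>C. V i * indicator A (a i) + indicator A (b i) :: real)"
      by (rule sum.cong[OF refl]) (simp add: min_def max_def algebra_simps)
    then show ?thesis
      unfolding sum_plan_index[of V "\<lambda>x. indicator A (fst x)"] mass_def by simp
  qed
  finally show ?thesis .
qed

lemma emeasure_second_law:
  assumes "admissible V" "A \<in> sets borel"
  shows "emeasure (second_law V) A = ennreal (mass b a V A)"
proof -
  have "emeasure (second_law V) A = emeasure (plan V) (UNIV \<times> A)"
    unfolding second_law_def using assms
    by (subst emeasure_distr) (auto simp: plan_def space_pair_measure intro!: arg_cong2[of _ _ _ _ emeasure])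
  also have "\<dots> = ennreal (\<Sum>j\<in>plan_index. plan_weight V j * indicator A (snd (plan_points j)))"
    using assms by (subst emeasure_plan) (auto simp: indicator_times)
  also have "(\<Sum>j\<in>plan_index. plan_weight V j * indicator A (snd (plan_points j))) = mass b a V A"
  proof -
    have "(\<Sum>i\<in>C. min (V i) 1 * (indicator A (snd (a i, a i)) + indicator A (snd (b i, b i)))
        + (max 0 (V i - 1) * indicator A (snd (a i, b i)) + max 0 (1 - V i) * indicator A (snd (b i, a i))))
      = (\<Sum>i\<in>C. V i * indicator A (b i) + indicator A (a i) :: real)"
      by (rule sum.cong[OF refl]) (simp add: min_def max_def algebra_simps)
    then show ?thesis
      unfolding sum_plan_index[of V "\<lambda>x. indicator A (snd x)"] mass_def by simp
  qed
  finally show ?thesis .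
qed

lemma mass_nonneg:
  assumes "admissible V"
  shows "0 \<le> mass u v V A"
  using assms kappa_pos unfolding mass_def admissible_def
  by (intro add_nonneg_nonneg mult_nonneg_nonneg sum_nonneg) auto

lemma mass_eq_1:
  assumes "z \<in> A" "\<And>i. i \<in> C \<Longrightarrow> u i \<in> A \<and> v i \<in> A"
  shows "mass u v V A = 1"
proof -
  have "(\<Sum>i\<in>C. V i * indicator A (u i) + indicator A (v i)) = (\<Sum>i\<in>C. 1 + V i)"
    using assms by (intro sum.cong) auto
  then show ?thesis using assms by (simp add: mass_def)
qed

lemma laws_prob_space:
  assumes "admissible V"
  shows "prob_space (first_law V)" "prob_space (second_law V)"
  using emeasure_first_law[OF assms, of UNIV] emeasure_second_law[OF assms, of UNIV]
  by (auto intro!: prob_spaceI simp: mass_eq_1 first_law_def second_law_def)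

lemma laws_points:
  assumes "admissible V"
  shows "emeasure (first_law V) points = 1" "emeasure (second_law V) points = 1"
  using emeasure_first_law[OF assms, of points] emeasure_second_law[OF assms, of points] finite_points
  by (auto simp: mass_eq_1 points_def finite_imp_closed)

lemma measure_laws_singleton:
  assumes "admissible V"
  shows "measure (first_law V) {x} = mass a b V {x}" "measure (second_law V) {x} = mass b a V {x}"
  using emeasure_first_law[OF assms, of "{x}"] emeasure_second_law[OF assms, of "{x}"]
  by (auto simp: measure_def mass_nonneg assms)

lemma laws_in_prob_measures_on:
  assumes "admissible V"
  shows "first_law V \<in> prob_measures_on unit_cube" "second_law V \<in> prob_measures_on unit_cube"
proof -
  have [measurable]: "(unit_cube :: (real ^ 'd) set) \<in> sets borel" by (simp add: unit_cube_eq)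
  have "mass a b V unit_cube = 1" "mass b a V unit_cube = 1"
    using in_cube by (auto intro!: mass_eq_1)
  then show "first_law V \<in> prob_measures_on unit_cube" "second_law V \<in> prob_measures_on unit_cube"
    using laws_prob_space[OF assms] emeasure_first_law[OF assms, of unit_cube] emeasure_second_law[OF assms, of unit_cube]
    by (auto simp: prob_measures_on_def measure_def)
qed

lemma transport_cost_le:
  assumes "admissible V"
  shows "transport_cost p (first_law V) (second_law V) \<le> ennreal (\<delta> powr p * (\<kappa> * (\<Sum>i\<in>C. \<bar>V i - 1\<bar>)))"
proof -
  have "transport_cost p (first_law V) (second_law V) \<le> (\<integral>\<^sup>+ x. ennreal (norm (fst x - snd x) powr p) \<partial>plan V)"
    unfolding transport_cost_def by (rule INF_lower) (rule plan_in_couplings)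
  also have "\<dots> = ennreal (\<Sum>j\<in>plan_index. plan_weight V j * norm (fst (plan_points j) - snd (plan_points j)) powr p)"
    using assms by (intro nn_integral_plan) auto
  also have "(\<Sum>j\<in>plan_index. plan_weight V j * norm (fst (plan_points j) - snd (plan_points j)) powr p)
    = \<delta> powr p * (\<kappa> * (\<Sum>i\<in>C. \<bar>V i - 1\<bar>))"
  proof -
    have "min (V i) 1 * 0 + (max 0 (V i - 1) * \<delta> powr p + max 0 (1 - V i) * \<delta> powr p) = \<delta> powr p * \<bar>V i - 1\<bar>" for i
      by (auto simp: max_def algebra_simps)
    then show ?thesis
      unfolding sum_plan_index[of V "\<lambda>x. norm (fst x - snd x) powr p"] using dist_pair dist_pair[unfolded norm_minus_commute[of "a _"]]
      by (simp add: mult.left_commute[of _ \<kappa>] flip: sum_distrib_left cong: sum.cong)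
  qed
  finally show ?thesis .
qed

text \<open>Duality with a single test set: A collects the points where the first law exceeds the
  second. Every coupling carries at least the excess mass of A to atoms outside A, and separation
  prices this at \<open>\<delta> powr p\<close> per unit.\<close>

lemma transport_cost_ge:
  assumes V: "admissible V" and p: "0 \<le> p"
  shows "ennreal (\<delta> powr p * (\<kappa> * (\<Sum>i\<in>C. \<bar>V i - 1\<bar>))) \<le> transport_cost p (first_law V) (second_law V)"
  unfolding transport_cost_def
proof (rule INF_greatest)
  fix \<pi> assume \<pi>: "\<pi> \<in> couplings (first_law V) (second_law V)"
  have sets_\<pi> [simp, measurable_cong]: "sets \<pi> = sets (borel \<Otimes>\<^sub>M borel)" and
    m: "distr \<pi> borel fst = first_law V" "distr \<pi> borel snd = second_law V"
    using \<pi> by (auto simp: couplings_def)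
  have sp: "space \<pi> = UNIV" using sets_eq_imp_space_eq[OF sets_\<pi>] by (simp add: space_pair_measure)
  have fst_m: "emeasure \<pi> (B \<times> UNIV) = emeasure (first_law V) B" if "B \<in> sets borel" for B
    unfolding m(1)[symmetric] using that
    by (subst emeasure_distr) (auto simp: sp intro!: arg_cong2[of _ _ _ _ emeasure])
  have snd_m: "emeasure \<pi> (UNIV \<times> B) = emeasure (second_law V) B" if "B \<in> sets borel" for B
    unfolding m(2)[symmetric] using that
    by (subst emeasure_distr) (auto simp: sp intro!: arg_cong2[of _ _ _ _ emeasure])
  define A where "A = a ` {i\<in>C. V i > 1} \<union> b ` {i\<in>C. V i < 1}"
  have A: "A \<subseteq> points" "z \<notin> A" using distinct_points by (auto simp: A_def points_def)
  have Aa: "a i \<in> A \<longleftrightarrow> V i > 1" if i: "i \<in> C" for i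
  proof
    assume "a i \<in> A"
    then consider j where "j \<in> C" "V j > 1" "a i = a j" | j where "j \<in> C" "a i = b j"
      by (auto simp: A_def)
    then show "V i > 1" by cases (use i inj distinct_points(1) in \<open>auto dest: inj_onD\<close>)
  qed (use i in \<open>simp add: A_def\<close>)
  have Ab: "b i \<in> A \<longleftrightarrow> V i < 1" if i: "i \<in> C" for i
  proof
    assume "b i \<in> A"
    then consider j where "j \<in> C" "V j < 1" "b i = b j" | j where "j \<in> C" "b i = a j"
      by (auto simp: A_def)
    then show "V i < 1" by cases (use i inj distinct_points(1)[of _ i] in \<open>auto dest: inj_onD\<close>)
  qed (use i in \<open>simp add: A_def\<close>)
  have [measurable]: "A \<in> sets borel" "points \<in> sets borel"
    using finite_points finite_subset[OF A(1) finite_points] by (simp_all add: finite_imp_closed)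
  let ?S = "A \<times> (points - A)"
  \<comment> \<open>Mass starting in A ends in A, at another atom, or off the atoms; the second law
    gives the last case measure 0.\<close>
  have "emeasure \<pi> (A \<times> UNIV) \<le> emeasure \<pi> ((UNIV \<times> A \<union> ?S) \<union> (UNIV \<times> (- points)))"
    by (intro emeasure_mono) (auto intro!: sets.Un)
  also have "\<dots> \<le> emeasure \<pi> (UNIV \<times> A) + emeasure \<pi> ?S + emeasure \<pi> (UNIV \<times> (- points))"
    by (intro order.trans[OF emeasure_subadditive] add_mono emeasure_subadditive) (auto intro!: sets.Un)
  also have "emeasure \<pi> (UNIV \<times> (- points)) = 0"
  proof -
    have "mass b a V (- points) = 0"
      by (auto simp: mass_def points_def intro!: sum.neutral)
    moreover have c: "- points \<in> sets borel" by (intro borel_comp) measurable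
    ultimately show ?thesis using emeasure_second_law[OF V c] by (simp add: snd_m[OF c])
  qed
  finally have "emeasure (first_law V) A \<le> emeasure (second_law V) A + emeasure \<pi> ?S"
    by (simp add: fst_m snd_m)
  then have "ennreal (mass a b V A - mass b a V A) \<le> emeasure \<pi> ?S"
    using V by (simp add: emeasure_first_law emeasure_second_law ennreal_minus[symmetric] mass_nonneg ennreal_minus_le_iff)
  \<comment> \<open>Each cell contributes (V i - 1) times the difference of the indicators of A at a
    i and b i, which has the sign of V i - 1.\<close>
  also have "mass a b V A - mass b a V A = \<kappa> * (\<Sum>i\<in>C. \<bar>V i - 1\<bar>)"
    unfolding mass_def using A(2)
    by (auto simp: right_diff_distrib[symmetric] sum_subtractf[symmetric] Aa Ab indicator_def intro!: sum.cong)
  finally have S: "ennreal (\<kappa> * (\<Sum>i\<in>C. \<bar>V i - 1\<bar>)) \<le> emeasure \<pi> ?S" .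
  have "ennreal (\<delta> powr p * (\<kappa> * (\<Sum>i\<in>C. \<bar>V i - 1\<bar>))) = ennreal (\<delta> powr p) * ennreal (\<kappa> * (\<Sum>i\<in>C. \<bar>V i - 1\<bar>))"
    by (simp add: ennreal_mult' )
  also have "\<dots> \<le> ennreal (\<delta> powr p) * emeasure \<pi> ?S" using S by (rule mult_left_mono) simp
  also have "\<dots> = (\<integral>\<^sup>+ x. ennreal (\<delta> powr p) * indicator ?S x \<partial>\<pi>)"
    by (subst nn_integral_cmult_indicator) auto
  also have "\<dots> \<le> (\<integral>\<^sup>+ x. ennreal (norm (fst x - snd x) powr p) \<partial>\<pi>)"
  proof (intro nn_integral_mono)
    fix x :: "(real ^ 'd) \<times> (real ^ 'd)"
    show "ennreal (\<delta> powr p) * indicator ?S x \<le> ennreal (norm (fst x - snd x) powr p)"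
    proof (cases "x \<in> ?S")
      case True
      then have "\<delta> \<le> norm (fst x - snd x)" using A by (intro separated) (auto simp: points_def)
      then show ?thesis using delta_pos p True by (auto intro!: ennreal_leI powr_mono2)
    qed simp
  qed
  finally show "ennreal (\<delta> powr p * (\<kappa> * (\<Sum>i\<in>C. \<bar>V i - 1\<bar>))) \<le> (\<integral>\<^sup>+ x. ennreal (norm (fst x - snd x) powr p) \<partial>\<pi>)" .
qed

lemma wasserstein_laws:
  assumes "admissible V" "1 \<le> p"
  shows "wasserstein p (first_law V) (second_law V) = \<delta> * (\<kappa> * (\<Sum>i\<in>C. \<bar>V i - 1\<bar>)) powr (1 / p)"
proof -
  have "0 \<le> \<kappa> * (\<Sum>i\<in>C. \<bar>V i - 1\<bar>)" using kappa_pos by (intro mult_nonneg_nonneg sum_nonneg) auto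
  moreover have "transport_cost p (first_law V) (second_law V) = ennreal (\<delta> powr p * (\<kappa> * (\<Sum>i\<in>C. \<bar>V i - 1\<bar>)))"
    using assms by (intro antisym transport_cost_le transport_cost_ge) auto
  ultimately show ?thesis
    using assms delta_pos unfolding wasserstein_def by (simp add: powr_mult powr_powr)
qed

lemma wasserstein_risk_laws:
  assumes "admissible V"
  shows "wasserstein_risk p n W (first_law V) (second_law V) =
    ennreal (\<Sum>x\<in>{..<n} \<rightarrow>\<^sub>E points. \<Sum>y\<in>{..<n} \<rightarrow>\<^sub>E points.
      (\<Prod>i<n. mass a b V {x i}) * (\<Prod>i<n. mass b a V {y i})
        * \<bar>W (x, y) - wasserstein p (first_law V) (second_law V)\<bar>)"
proof -
  have "wasserstein_risk p n W (first_law V) (second_law V) = (\<Sum>x\<in>{..<n} \<rightarrow>\<^sub>E points. \<Sum>y\<in>{..<n} \<rightarrow>\<^sub>E points.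
      ennreal ((\<Prod>i<n. mass a b V {x i}) * (\<Prod>i<n. mass b a V {y i})) * ennreal \<bar>W (x, y) - wasserstein p (first_law V) (second_law V)\<bar>)"
    unfolding wasserstein_risk_def measure_laws_singleton[OF assms, symmetric]
    using assms by (intro nn_integral_two_sample_law laws_prob_space laws_points finite_points) auto
  also have "\<dots> = (\<Sum>x\<in>{..<n} \<rightarrow>\<^sub>E points. ennreal (\<Sum>y\<in>{..<n} \<rightarrow>\<^sub>E points.
      (\<Prod>i<n. mass a b V {x i}) * (\<Prod>i<n. mass b a V {y i}) * \<bar>W (x, y) - wasserstein p (first_law V) (second_law V)\<bar>))"
    using mass_nonneg[OF assms]
    by (intro sum.cong refl, subst sum_ennreal[symmetric])
      (auto simp: ennreal_mult prod_nonneg intro!: mult_nonneg_nonneg prod_nonneg)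
  also have "\<dots> = ennreal (\<Sum>x\<in>{..<n} \<rightarrow>\<^sub>E points. \<Sum>y\<in>{..<n} \<rightarrow>\<^sub>E points.
      (\<Prod>i<n. mass a b V {x i}) * (\<Prod>i<n. mass b a V {y i}) * \<bar>W (x, y) - wasserstein p (first_law V) (second_law V)\<bar>)"
    using mass_nonneg[OF assms]
    by (intro sum_ennreal sum_nonneg mult_nonneg_nonneg prod_nonneg) auto
  finally show ?thesis .
qed

end

section \<open>From estimators to tests, and bounds on sample likelihoods\<close>

lemma chi_square_bound:
  fixes P Q g :: "'s \<Rightarrow> real"
  assumes S: "finite S" "\<And>s. s \<in> S \<Longrightarrow> 0 < Q s" "(\<Sum>s\<in>S. P s) = 1" "(\<Sum>s\<in>S. Q s) = 1"
    and g: "\<And>s. s \<in> S \<Longrightarrow> \<bar>g s\<bar> \<le> 1"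
  shows "((\<Sum>s\<in>S. P s * g s) - (\<Sum>s\<in>S. Q s * g s))\<^sup>2 \<le> (\<Sum>s\<in>S. (P s)\<^sup>2 / Q s) - 1"
proof -
  \<comment> \<open>Cauchy-Schwarz after splitting off sqrt (Q s): one factor is the chi-square
    divergence, the other is at most the total mass of Q.\<close>
  have "(\<Sum>s\<in>S. P s * g s) - (\<Sum>s\<in>S. Q s * g s) = (\<Sum>s\<in>S. ((P s - Q s) / sqrt (Q s)) * (sqrt (Q s) * g s))"
    unfolding sum_subtractf[symmetric]
  proof (intro sum.cong refl)
    fix s assume "s \<in> S"
    then have "sqrt (Q s) \<noteq> 0" using S(2)[of s] by simp
    then have "(P s - Q s) / sqrt (Q s) * sqrt (Q s) = P s - Q s" by simp
    then show "P s * g s - Q s * g s = ((P s - Q s) / sqrt (Q s)) * (sqrt (Q s) * g s)"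
      by (simp only: mult.assoc[symmetric] left_diff_distrib)
  qed
  then have "((\<Sum>s\<in>S. P s * g s) - (\<Sum>s\<in>S. Q s * g s))\<^sup>2 \<le>
      (\<Sum>s\<in>S. ((P s - Q s) / sqrt (Q s))\<^sup>2) * (\<Sum>s\<in>S. (sqrt (Q s) * g s)\<^sup>2)"
    by (simp only: Cauchy_Schwarz_ineq_sum)
  also have "(\<Sum>s\<in>S. (sqrt (Q s) * g s)\<^sup>2) \<le> (\<Sum>s\<in>S. Q s)"
  proof (intro sum_mono)
    fix s assume s: "s \<in> S"
    have "(g s)\<^sup>2 \<le> 1" using g[OF s] by (simp add: abs_square_le_1)
    then show "(sqrt (Q s) * g s)\<^sup>2 \<le> Q s" using S(2)[OF s]
      by (simp add: power_mult_distrib mult_left_le)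
  qed
  then have "(\<Sum>s\<in>S. ((P s - Q s) / sqrt (Q s))\<^sup>2) * (\<Sum>s\<in>S. (sqrt (Q s) * g s)\<^sup>2) \<le> (\<Sum>s\<in>S. ((P s - Q s) / sqrt (Q s))\<^sup>2) * 1"
    using S(4) by (intro mult_left_mono sum_nonneg) auto
  also have "(\<Sum>s\<in>S. ((P s - Q s) / sqrt (Q s))\<^sup>2) = (\<Sum>s\<in>S. (P s)\<^sup>2 / Q s - 2 * P s + Q s)"
  proof (intro sum.cong refl)
    fix s assume "s \<in> S"
    then show "((P s - Q s) / sqrt (Q s))\<^sup>2 = (P s)\<^sup>2 / Q s - 2 * P s + Q s"
      using S(2)[of s] by (simp add: power_divide power2_eq_square field_simps)
  qed
  also have "(\<Sum>s\<in>S. (P s)\<^sup>2 / Q s - 2 * P s + Q s) * 1 = (\<Sum>s\<in>S. (P s)\<^sup>2 / Q s) - 1"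
    using S by (simp add: sum.distrib sum_subtractf flip: sum_distrib_left)
  finally show ?thesis .
qed

context paired_cells
begin

lemma sum_indicator_points:
  assumes "y \<in> points"
  shows "(\<Sum>x\<in>points. indicator {x} y) = (1 :: real)"
proof -
  have "(\<Sum>x\<in>points. indicator {x} y) = (\<Sum>x\<in>points. if x = y then 1 else (0 :: real))"
    by (intro sum.cong) (auto simp: indicator_def)
  then show ?thesis using assms finite_points by simp
qed

lemma sum_mass_singleton:
  assumes "u ` C \<union> v ` C \<subseteq> points"
  shows "(\<Sum>x\<in>points. mass u v V {x}) = 1"
proof -
  have z: "z \<in> points" by (simp add: points_def)
  have "(\<Sum>x\<in>points. mass u v V {x}) = (1 - \<kappa> * (\<Sum>i\<in>C. 1 + V i)) * (\<Sum>x\<in>points. indicator {x} z)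
     + \<kappa> * (\<Sum>x\<in>points. \<Sum>i\<in>C. V i * indicator {x} (u i) + indicator {x} (v i))"
    unfolding mass_def by (subst sum.distrib) (simp only: sum_distrib_left)
  also have "(\<Sum>x\<in>points. \<Sum>i\<in>C. V i * indicator {x} (u i) + indicator {x} (v i)) = (\<Sum>i\<in>C. 1 + V i)"
  proof (subst sum.swap, intro sum.cong refl)
    fix i assume "i \<in> C"
    then show "(\<Sum>x\<in>points. V i * indicator {x} (u i) + indicator {x} (v i)) = 1 + V i"
      using assms by (simp add: sum.distrib sum_indicator_points image_subset_iff flip: sum_distrib_left)
  qed
  finally show ?thesis using sum_indicator_points[OF z] by simp
qed

lemma sum_mass_ab:
  "(\<Sum>x\<in>points. mass a b V {x}) = 1" "(\<Sum>x\<in>points. mass b a V {x}) = 1"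
  by (rule sum_mass_singleton; auto simp: points_def)+

definition law_expect :: "nat \<Rightarrow> ('c \<Rightarrow> real) \<Rightarrow> ((nat \<Rightarrow> real ^ 'd) \<times> (nat \<Rightarrow> real ^ 'd) \<Rightarrow> real) \<Rightarrow> real" where
  "law_expect n V g = (\<Sum>x\<in>{..<n} \<rightarrow>\<^sub>E points. \<Sum>y\<in>{..<n} \<rightarrow>\<^sub>E points.
      (\<Prod>i<n. mass a b V {x i}) * (\<Prod>i<n. mass b a V {y i}) * g (x, y))"

lemma sum_prod_mass:
  fixes n :: nat
  shows "(\<Sum>x\<in>{..<n} \<rightarrow>\<^sub>E points. \<Prod>i<n. mass a b V {x i}) = 1"
  "(\<Sum>x\<in>{..<n} \<rightarrow>\<^sub>E points. \<Prod>i<n. mass b a V {x i}) = 1"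
  using prod_sum_PiE[of "{..<n}" "\<lambda>_. points" "\<lambda>_ y. mass a b V {y}"]
    prod_sum_PiE[of "{..<n}" "\<lambda>_. points" "\<lambda>_ y. mass b a V {y}"]
  by (simp_all add: finite_points sum_mass_ab)

lemma law_expect_1: "law_expect n V (\<lambda>_. 1) = 1"
  using sum_prod_mass[of V n]
  by (simp add: law_expect_def flip: sum_product)

lemma law_expect_mono:
  assumes "admissible V" "\<And>x. g x \<le> h x"
  shows "law_expect n V g \<le> law_expect n V h"
  unfolding law_expect_def using mass_nonneg[OF assms(1)] assms(2)
  by (intro sum_mono mult_left_mono mult_nonneg_nonneg prod_nonneg) auto

lemma law_expect_cmult: "law_expect n V (\<lambda>x. c * g x) = c * law_expect n V g"
  by (simp add: law_expect_def sum_distrib_left mult_ac)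

lemma law_expect_diff: "law_expect n V (\<lambda>x. g x - h x) = law_expect n V g - law_expect n V h"
  by (simp add: law_expect_def right_diff_distrib sum_subtractf)

lemma law_expect_bounds:
  assumes "admissible V" "\<And>x. 0 \<le> g x \<and> g x \<le> 1"
  shows "0 \<le> law_expect n V g" "law_expect n V g \<le> 1"
  using law_expect_mono[OF assms(1), of "\<lambda>_. 0" g n] law_expect_mono[OF assms(1), of g "\<lambda>_. 1" n] assms(2)
    law_expect_1[of n V] by (auto simp: law_expect_def)

lemma wasserstein_risk_law_expect:
  assumes "admissible V"
  shows "wasserstein_risk p n W (first_law V) (second_law V) =
    ennreal (law_expect n V (\<lambda>x. \<bar>W x - wasserstein p (first_law V) (second_law V)\<bar>))"
  unfolding wasserstein_risk_laws[OF assms] law_expect_def ..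

text \<open>A randomised test between distances at most lo and at least hi. Being a ramp instead of
  a cut, it errs pointwise by at most the estimation error divided by hi - lo, so the risk bounds
  its error directly.\<close>

definition clamp_test :: "real \<Rightarrow> real \<Rightarrow> ('z \<Rightarrow> real) \<Rightarrow> 'z \<Rightarrow> real" where
  "clamp_test lo hi W x = max 0 (min 1 ((W x - lo) / (hi - lo)))"

lemma clamp_test_bounds: "0 \<le> clamp_test lo hi W x \<and> clamp_test lo hi W x \<le> 1"
  by (auto simp: clamp_test_def)

lemma law_expect_clamp_test:
  assumes V: "admissible V" and lohi: "lo < hi" and r: "0 \<le> r"
    and risk: "wasserstein_risk p n W (first_law V) (second_law V) < ennreal r"
  shows "wasserstein p (first_law V) (second_law V) \<le> lo \<Longrightarrow> law_expect n V (clamp_test lo hi W) \<le> r / (hi - lo)"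
    and "hi \<le> wasserstein p (first_law V) (second_law V) \<Longrightarrow> 1 - r / (hi - lo) \<le> law_expect n V (clamp_test lo hi W)"
proof -
  let ?w = "wasserstein p (first_law V) (second_law V)"
  let ?e = "\<lambda>x. 1 / (hi - lo) * \<bar>W x - ?w\<bar>"
  have "0 \<le> law_expect n V (\<lambda>x. \<bar>W x - ?w\<bar>)"
    using law_expect_mono[OF V, of "\<lambda>_. 0" "\<lambda>x. \<bar>W x - ?w\<bar>" n] by (simp add: law_expect_def)
  then have "law_expect n V (\<lambda>x. \<bar>W x - ?w\<bar>) \<le> r"
    using risk r unfolding wasserstein_risk_law_expect[OF V] by (simp add: ennreal_less_iff)
  then have e: "law_expect n V ?e \<le> r / (hi - lo)"
    using lohi unfolding law_expect_cmult by (simp add: divide_right_mono)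
  show "law_expect n V (clamp_test lo hi W) \<le> r / (hi - lo)" if w: "?w \<le> lo"
  proof -
    have "clamp_test lo hi W x \<le> ?e x" for x
    proof -
      have "(W x - lo) / (hi - lo) \<le> \<bar>W x - ?w\<bar> / (hi - lo)"
        using w lohi by (intro divide_right_mono) auto
      then show ?thesis using lohi by (auto simp: clamp_test_def)
    qed
    then have "law_expect n V (clamp_test lo hi W) \<le> law_expect n V ?e" by (intro law_expect_mono V)
    with e show ?thesis by linarith
  qed
  show "1 - r / (hi - lo) \<le> law_expect n V (clamp_test lo hi W)" if w: "hi \<le> ?w"
  proof -
    have "1 - ?e x \<le> clamp_test lo hi W x" for x
    proof -
      have "(hi - W x) / (hi - lo) \<le> \<bar>W x - ?w\<bar> / (hi - lo)"
        using w lohi by (intro divide_right_mono) auto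
      moreover have "1 - (hi - W x) / (hi - lo) = (W x - lo) / (hi - lo)"
        using lohi by (simp add: field_simps)
      moreover have "0 \<le> \<bar>W x - ?w\<bar> / (hi - lo)" using lohi by simp
      ultimately show ?thesis by (auto simp: clamp_test_def)
    qed
    then have "law_expect n V (\<lambda>x. 1 - ?e x) \<le> law_expect n V (clamp_test lo hi W)" by (intro law_expect_mono V)
    with e show ?thesis unfolding law_expect_diff law_expect_1 by linarith
  qed
qed

text \<open>Raising V i moves mass from \<open>z\<close> to u i at rate \<kappa>; the value at V i =
  0 is the constant term.\<close>

lemma mass_upd:
  assumes "i \<in> C"
  shows "mass u v (V(i := t)) A = mass u v (V(i := 0)) A + t * (\<kappa> * (indicator A (u i) - indicator A z))"
proof -
  have e: "(\<Sum>j\<in>C. 1 + (V(i := t)) j) = t + (\<Sum>j\<in>C. 1 + (V(i := 0)) j)"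
    "(\<Sum>j\<in>C. (V(i := t)) j * indicator A (u j) + indicator A (v j))
     = t * indicator A (u i) + (\<Sum>j\<in>C. (V(i := 0)) j * indicator A (u j) + indicator A (v j))"
    unfolding sum.remove[OF finite_C assms] by (auto intro!: sum.cong arg_cong2[of _ _ _ _ "(+)"])
  show ?thesis unfolding mass_def e by (simp add: algebra_simps)
qed

lemma sum_abs_mass_slope_le:
  assumes "y \<in> points"
  shows "(\<Sum>x\<in>points. \<bar>\<kappa> * (indicator {x} y - indicator {x} z)\<bar>) \<le> 2 * \<kappa>"
proof -
  have "(\<Sum>x\<in>points. \<bar>\<kappa> * (indicator {x} y - indicator {x} z)\<bar>) \<le> (\<Sum>x\<in>points. \<kappa> * (indicator {x} y + indicator {x} z))"
    using kappa_pos by (intro sum_mono) (auto simp: abs_mult indicator_def)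
  also have "\<dots> = 2 * \<kappa>"
    using sum_indicator_points[OF assms] sum_indicator_points[of z] by (simp add: sum.distrib points_def[symmetric] flip: sum_distrib_left) (simp add: points_def)
  finally show ?thesis .
qed

text \<open>With the other coordinates fixed, \<open>two_sample_moment_bound\<close> applies: the
  masses at V i = 0 are the constant terms, and each slope has l1 norm at most 2 \<kappa>.\<close>

lemma law_expect_swap:
  fixes w w' X :: "'k \<Rightarrow> real"
  assumes i: "i \<in> C" and V: "admissible (V(i := 0))" and D: "finite D"
    and w: "\<And>x. x \<in> D \<Longrightarrow> 0 \<le> w x" "\<And>x. x \<in> D \<Longrightarrow> 0 \<le> w' x"
      "(\<Sum>x\<in>D. w x) = 1" "(\<Sum>x\<in>D. w' x) = 1"
    and X: "\<And>x. x \<in> D \<Longrightarrow> 0 \<le> X x \<and> X x \<le> R"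
    and mom: "\<And>j. j < L \<Longrightarrow> (\<Sum>x\<in>D. w x * X x ^ j) = (\<Sum>x\<in>D. w' x * X x ^ j)"
    and g: "\<And>x. \<bar>g x\<bar> \<le> 1" and pos: "1 \<le> \<theta>" "0 \<le> R"
  shows "\<bar>\<Sum>x\<in>D. (w x - w' x) * law_expect n (V(i := X x)) g\<bar> \<le> (1 + \<theta> * (2 * \<kappa>) * R) ^ (2 * n) / \<theta> ^ L"
proof -
  have p: "a i \<in> points" "b i \<in> points" using i by (auto simp: points_def)
  have "\<bar>\<Sum>k\<in>D. (w k - w' k) * (\<Sum>x\<in>{..<n} \<rightarrow>\<^sub>E points. \<Sum>y\<in>{..<n} \<rightarrow>\<^sub>E points.
      (\<Prod>j<n. mass a b (V(i := 0)) {x j} + X k * (\<kappa> * (indicator {x j} (a i) - indicator {x j} z)))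
      * (\<Prod>j<n. mass b a (V(i := 0)) {y j} + X k * (\<kappa> * (indicator {y j} (b i) - indicator {y j} z))) * g (x, y))\<bar>
     \<le> (1 + \<theta> * (2 * \<kappa>) * R) ^ (2 * card {..<n}) / \<theta> ^ L"
    by (rule two_sample_moment_bound[where T = "\<lambda>x y. g (x, y)", OF D finite_lessThan finite_points w X mom
        mass_nonneg[OF V] sum_mass_ab(1) sum_abs_mass_slope_le[OF p(1)]
        mass_nonneg[OF V] sum_mass_ab(2) sum_abs_mass_slope_le[OF p(2)] g pos])
  then show ?thesis unfolding law_expect_def mass_upd[OF i, of _ _ _ "X _"] by simp
qed

text \<open>One plus the chi-square divergence is multiplicative over independent observations, here
  n from each law.\<close>

lemma law_expect_chi_square:
  assumes Q: "\<And>x. x \<in> points \<Longrightarrow> 0 < mass a b V {x}" "\<And>x. x \<in> points \<Longrightarrow> 0 < mass b a V {x}"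
    and g: "\<And>x. \<bar>g x\<bar> \<le> 1"
  shows "(law_expect n V' g - law_expect n V g)\<^sup>2 \<le>
    (\<Sum>x\<in>points. (mass a b V' {x})\<^sup>2 / mass a b V {x}) ^ n * (\<Sum>x\<in>points. (mass b a V' {x})\<^sup>2 / mass b a V {x}) ^ n - 1"
proof -
  let ?X = "{..<n} \<rightarrow>\<^sub>E points"
  let ?P = "\<lambda>V s. (\<Prod>i<n. mass a b V {fst s i}) * (\<Prod>i<n. mass b a V {snd s i})"
  have e: "law_expect n V g = (\<Sum>s\<in>?X \<times> ?X. ?P V s * g s)" for V g
    by (simp add: law_expect_def sum.cartesian_product case_prod_unfold)
  have one: "(\<Sum>s\<in>?X \<times> ?X. ?P V s) = 1" for V
    using law_expect_1[of n V] unfolding e mult_1_right .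
  have pos: "0 < ?P V s" if "s \<in> ?X \<times> ?X" for s
  proof -
    have "fst s i \<in> points" "snd s i \<in> points" if "i < n" for i
      using \<open>s \<in> ?X \<times> ?X\<close> that by (auto simp: mem_Times_iff PiE_iff)
    then show ?thesis by (intro mult_pos_pos prod_pos Q) auto
  qed
  have "(law_expect n V' g - law_expect n V g)\<^sup>2 \<le> (\<Sum>s\<in>?X \<times> ?X. (?P V' s)\<^sup>2 / ?P V s) - 1"
    unfolding e
    by (rule chi_square_bound[OF _ pos one one g]) (simp_all add: finite_points finite_PiE)
  also have "(\<Sum>s\<in>?X \<times> ?X. (?P V' s)\<^sup>2 / ?P V s) =
     (\<Sum>(x, y)\<in>?X \<times> ?X. (\<Prod>i<n. (mass a b V' {x i})\<^sup>2 / mass a b V {x i}) * (\<Prod>i<n. (mass b a V' {y i})\<^sup>2 / mass b a V {y i}))"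
    unfolding case_prod_unfold
    by (simp only: power_mult_distrib prod_power_distrib prod_dividef times_divide_times_eq)
  also have "\<dots> = (\<Sum>x\<in>?X. \<Prod>i<n. (mass a b V' {x i})\<^sup>2 / mass a b V {x i}) * (\<Sum>y\<in>?X. \<Prod>i<n. (mass b a V' {y i})\<^sup>2 / mass b a V {y i})"
    by (simp add: sum.cartesian_product[symmetric] sum_product)
  also have "\<dots> = (\<Sum>x\<in>points. (mass a b V' {x})\<^sup>2 / mass a b V {x}) ^ n * (\<Sum>x\<in>points. (mass b a V' {x})\<^sup>2 / mass b a V {x}) ^ n"
    using prod_sum_PiE[of "{..<n}" "\<lambda>_. points" "\<lambda>_ y. (mass a b V' {y})\<^sup>2 / mass a b V {y}"]
      prod_sum_PiE[of "{..<n}" "\<lambda>_. points" "\<lambda>_ y. (mass b a V' {y})\<^sup>2 / mass b a V {y}"]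
    by (simp add: finite_points)
  finally show ?thesis .
qed

end

section \<open>Comparison of the two mixtures\<close>

context paired_cells
begin

text \<open>Without the guard, the mass at the common point could become negative.\<close>

definition guarded_expect :: "nat \<Rightarrow> ((nat \<Rightarrow> real ^ 'd) \<times> (nat \<Rightarrow> real ^ 'd) \<Rightarrow> real) \<Rightarrow> ('c \<Rightarrow> real) \<Rightarrow> real" where
  "guarded_expect n g V = (if (\<Sum>i\<in>C. V i) \<le> 63 * real (card C) then law_expect n V g else 0)"

text \<open>63 = 64 - 1: the unit mass at the second point of each cell already uses
  \<open>card C\<close> of the budget \<open>64 * card C\<close>.\<close>

lemma admissible_if_sum_le:
  assumes "\<kappa> = 1 / (64 * real (card C))" "\<And>i. i \<in> C \<Longrightarrow> 0 \<le> V i" "(\<Sum>i\<in>C. V i) \<le> 63 * real (card C)"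
  shows "admissible V"
proof -
  have "card C > 0" using assms(1) kappa_pos by (cases "card C = 0") auto
  then have "\<kappa> * (64 * real (card C)) = 1" using assms(1) by simp
  moreover have "\<kappa> * (\<Sum>i\<in>C. 1 + V i) \<le> \<kappa> * (64 * real (card C))"
    using assms(3) kappa_pos by (intro mult_left_mono) (auto simp: sum.distrib)
  ultimately show ?thesis using assms(2) by (simp add: admissible_def)
qed

lemma guarded_expect_bounds:
  assumes "\<kappa> = 1 / (64 * real (card C))" "\<And>i. i \<in> C \<Longrightarrow> 0 \<le> V i" "\<And>x. 0 \<le> g x \<and> g x \<le> 1"
  shows "0 \<le> guarded_expect n g V \<and> guarded_expect n g V \<le> 1"
  using law_expect_bounds[of V g n] admissible_if_sum_le[OF assms(1,2)] assms(3)
  by (auto simp: guarded_expect_def)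

text \<open>If the other coordinates sum to at most 40 m, a further value of at most R <= m cannot
  trigger the guard, and \<open>law_expect_swap\<close> applies. Otherwise the trivial bound 1 <=
  exp ((s - 40 m) / R) is used; its average is small because the mean of each coordinate is at most
  16.\<close>

lemma guarded_expect_indistinguishable:
  fixes w w' X :: "'k \<Rightarrow> real" and K :: nat
  defines "m \<equiv> real (card C)" and "R \<equiv> 16 * real K ^ 2"
  assumes \<kappa>: "\<kappa> = 1 / (64 * real (card C))"
    and K: "0 < K" "8 * real n * real K \<le> m" "R \<le> m"
    and D: "finite D"
    and w: "\<And>x. x \<in> D \<Longrightarrow> 0 \<le> w x" "\<And>x. x \<in> D \<Longrightarrow> 0 \<le> w' x"
      "(\<Sum>x\<in>D. w x) = 1" "(\<Sum>x\<in>D. w' x) = 1"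
    and X: "\<And>x. x \<in> D \<Longrightarrow> 0 \<le> X x \<and> X x \<le> R"
    and mom: "\<And>j. j < 2 * K \<Longrightarrow> (\<Sum>x\<in>D. w x * X x ^ j) = (\<Sum>x\<in>D. w' x * X x ^ j)"
    and mean: "(\<Sum>x\<in>D. w x * X x) \<le> 16"
    and g: "\<And>x. 0 \<le> g x \<and> g x \<le> 1"
  shows "\<bar>prod_expect C D (\<lambda>_. w) (\<lambda>k. guarded_expect n g (\<lambda>i. X (k i)))
     - prod_expect C D (\<lambda>_. w') (\<lambda>k. guarded_expect n g (\<lambda>i. X (k i)))\<bar>
     \<le> m * (exp (- 3 * real K) + exp (- 8 * m / R))"
proof -
  have R: "0 < R" using K(1) by (simp add: R_def)
  have m: "0 < m" using R K(3) by linarith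
  have mean': "(\<Sum>x\<in>D. w' x * X x) \<le> 16" using mom[of 1] mean K(1) by simp
  define h where "h x = exp (1 * X x / R)" for x
  \<comment> \<open>The exponent is (1 + 1^2) * 16 / R, from \<open>sum_exp_le\<close> with s =
    1.\<close>
  define H where "H = exp (32 / R)"
  have hH: "(\<Sum>x\<in>D. u x * h x) \<le> H"
    if u: "\<And>x. x \<in> D \<Longrightarrow> 0 \<le> u x" "(\<Sum>x\<in>D. u x) = 1" "(\<Sum>x\<in>D. u x * X x) \<le> 16" for u
  proof -
    have "(\<Sum>x\<in>D. u x * h x) \<le> exp ((1 + 1\<^sup>2) * (\<Sum>x\<in>D. u x * X x) / R)"
      unfolding h_def by (rule sum_exp_le[OF u(1,2) X R]) auto
    also have "\<dots> \<le> H" unfolding H_def using u(3) R by (simp add: divide_right_mono)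
    finally show ?thesis .
  qed
  have "\<bar>prod_expect C D (\<lambda>_. w) (\<lambda>k. guarded_expect n g (\<lambda>i. X (k i)))
     - prod_expect C D (\<lambda>_. w') (\<lambda>k. guarded_expect n g (\<lambda>i. X (k i)))\<bar>
     \<le> real (card C) * (exp (- 3 * real K) + exp (- 40 * m / R) * H ^ card C)"
  proof (rule prod_expect_hybrid[where h = h])
    show "finite C" "finite D" by (fact finite_C, fact D)
    show "0 \<le> w x" "0 \<le> w' x" if "x \<in> D" for x using w that by auto
    show "(\<Sum>x\<in>D. w x) = 1" "(\<Sum>x\<in>D. w' x) = 1" by fact+
    show "0 \<le> h x" for x by (simp add: h_def)
    show "(\<Sum>x\<in>D. w x * h x) \<le> H" "(\<Sum>x\<in>D. w' x * h x) \<le> H"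
      using hH w mean mean' by auto
    show "1 \<le> H" using R by (simp add: H_def)
    show "0 \<le> exp (- 40 * m / R)" by simp
  next
    fix i k assume i: "i \<in> C" and k: "k \<in> (C - {i}) \<rightarrow>\<^sub>E D"
    define U where "U j = X (k j)" for j
    have U: "0 \<le> U j" if "j \<in> C - {i}" for j using k that X by (auto simp: U_def PiE_iff)
    define s where "s = (\<Sum>j\<in>C - {i}. U j)"
    have upd: "(\<lambda>j. X ((k(i := x)) j)) = U(i := X x)" for x by (auto simp: U_def fun_eq_iff)
    have tot: "(\<Sum>j\<in>C. (U(i := t)) j) = t + s" for t
      unfolding s_def sum.remove[OF finite_C i] by (auto intro!: sum.cong arg_cong2[of _ _ _ _ "(+)"])
    have nn: "0 \<le> (U(i := t)) j" if "j \<in> C" "0 \<le> t" for j t using U that by auto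
    have prod_h: "(\<Prod>j\<in>C - {i}. h (k j)) = exp (s / R)"
      using finite_C by (simp add: h_def s_def U_def exp_sum sum_divide_distrib)
    show "\<bar>\<Sum>x\<in>D. (w x - w' x) * guarded_expect n g (\<lambda>j. X ((k(i := x)) j))\<bar>
       \<le> exp (- 3 * real K) + exp (- 40 * m / R) * (\<Prod>j\<in>C - {i}. h (k j))"
    proof (cases "s \<le> 40 * m")
      case True
      have adm: "admissible (U(i := t))" if "0 \<le> t" "t \<le> R" for t
        using that True K(3) m tot[of t] nn by (intro admissible_if_sum_le[OF \<kappa>]) (auto simp: m_def)
      have "(\<Sum>x\<in>D. (w x - w' x) * guarded_expect n g (\<lambda>j. X ((k(i := x)) j)))
         = (\<Sum>x\<in>D. (w x - w' x) * law_expect n (U(i := X x)) g)"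
      proof (intro sum.cong refl)
        fix x assume "x \<in> D"
        then have "X x + s \<le> 63 * m" using X[of x] True K(3) m by linarith
        then show "(w x - w' x) * guarded_expect n g (\<lambda>j. X ((k(i := x)) j)) = (w x - w' x) * law_expect n (U(i := X x)) g"
          unfolding upd guarded_expect_def tot by (simp add: m_def)
      qed
      \<comment> \<open>The choice \<theta> = exp 2 gives the denominator exp (4 K), whereas the
        numerator is at most exp K because m >= 8 n K and exp 2 <= 8.\<close>
      also have "\<bar>\<dots>\<bar> \<le> (1 + exp 2 * (2 * \<kappa>) * R) ^ (2 * n) / exp 2 ^ (2 * K)"
        using R g by (intro law_expect_swap[OF i adm D w X mom]) auto
      also have "\<dots> \<le> exp (exp 2 * (2 * \<kappa>) * R) ^ (2 * n) / exp 2 ^ (2 * K)"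
        using R kappa_pos by (intro divide_right_mono power_mono exp_ge_add_one_self) auto
      also have "\<dots> = exp (real n * exp 2 * real K ^ 2 / m - 4 * real K)"
      proof -
        have "exp (exp 2 * (2 * \<kappa>) * R) ^ (2 * n) / exp 2 ^ (2 * K)
          = exp (real (2 * n) * (exp 2 * (2 * \<kappa>) * R) - real (2 * K) * 2)"
          by (simp only: exp_of_nat_mult exp_diff)
        also have "real (2 * n) * (exp 2 * (2 * \<kappa>) * R) - real (2 * K) * 2 = real n * exp 2 * real K ^ 2 / m - 4 * real K"
          by (simp add: \<kappa> R_def m_def)
        finally show ?thesis .
      qed
      also have "real n * exp 2 * real K ^ 2 / m - 4 * real K \<le> - 3 * real K"
      proof -
        have "exp 2 = (exp 1 :: real)\<^sup>2" by (simp flip: exp_of_nat_mult)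
        also have "\<dots> \<le> (272 / 100)\<^sup>2" using e_less_272 by (intro power_mono) auto
        also have "\<dots> \<le> (8 :: real)" by (simp add: power2_eq_square)
        finally have e: "exp 2 \<le> (8 :: real)" .
        have "real n * exp 2 * real K ^ 2 = (exp 2 * real n * real K) * real K" by (simp add: power2_eq_square)
        also have "\<dots> \<le> (8 * real n * real K) * real K" using e by (intro mult_right_mono) auto
        also have "\<dots> \<le> m * real K" using K by (intro mult_right_mono) auto
        finally have "real n * exp 2 * real K ^ 2 / m \<le> real K" using m by (simp add: field_simps)
        then show ?thesis by simp
      qed
      finally show ?thesis unfolding prod_h by (simp add: add_increasing2)
    next
      case False
      have b: "0 \<le> guarded_expect n g (\<lambda>j. X ((k(i := x)) j)) \<and> guarded_expect n g (\<lambda>j. X ((k(i := x)) j)) \<le> 1"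
        if "x \<in> D" for x
        unfolding upd using nn X[OF that] by (intro guarded_expect_bounds[OF \<kappa> _ g]) auto
      have b2: "0 \<le> (\<Sum>x\<in>D. u x * guarded_expect n g (\<lambda>j. X ((k(i := x)) j))) \<and>
          (\<Sum>x\<in>D. u x * guarded_expect n g (\<lambda>j. X ((k(i := x)) j))) \<le> 1"
        if u: "\<And>x. x \<in> D \<Longrightarrow> 0 \<le> u x" "(\<Sum>x\<in>D. u x) = 1" for u
      proof
        show "0 \<le> (\<Sum>x\<in>D. u x * guarded_expect n g (\<lambda>j. X ((k(i := x)) j)))"
          using b u by (intro sum_nonneg) auto
        have "(\<Sum>x\<in>D. u x * guarded_expect n g (\<lambda>j. X ((k(i := x)) j))) \<le> (\<Sum>x\<in>D. u x)"
          using b u by (intro sum_mono mult_left_le) auto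
        then show "(\<Sum>x\<in>D. u x * guarded_expect n g (\<lambda>j. X ((k(i := x)) j))) \<le> 1" using u by simp
      qed
      have "\<bar>\<Sum>x\<in>D. (w x - w' x) * guarded_expect n g (\<lambda>j. X ((k(i := x)) j))\<bar> \<le> 1"
        using b2[OF w(1,3)] b2[OF w(2,4)] by (auto simp: left_diff_distrib sum_subtractf)
      also have "1 \<le> exp (- 40 * m / R) * exp (s / R)"
        using False R by (simp flip: exp_add add: field_simps)
      finally show ?thesis unfolding prod_h by (simp add: add_increasing)
    qed
  qed
  also have "exp (- 40 * m / R) * H ^ card C = exp (- 8 * m / R)"
    by (simp add: H_def m_def flip: exp_of_nat_mult exp_add add_divide_distrib)
  finally show ?thesis by (simp add: m_def)
qed

text \<open>Le Cam's method with two mixtures. The average of \<open>|V i - 1|\<close> concentrates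
  at \<tau> w' or \<tau> w; margins of 1/16 on both sides leave half of the gap 1/4, hence lo < hi.
  A risk below (hi - lo) / 8 at every admissible V would yield a test with guarded mean at most 3/16
  under w' and at least 3/4 under w, although these means differ by at most 1/8.\<close>

lemma minimax_contradiction:
  fixes w w' X :: "'k \<Rightarrow> real" and K n :: nat and D :: "'k set" and p :: real
  defines "m \<equiv> real (card C)" and "R \<equiv> 16 * real K ^ 2"
  defines "\<tau> \<equiv> \<lambda>u. \<Sum>x\<in>D. u x * \<bar>X x - 1\<bar>"
  defines "lo \<equiv> \<delta> * ((\<tau> w' + 1 / 16) / 64) powr (1 / p)" and "hi \<equiv> \<delta> * ((\<tau> w - 1 / 16) / 64) powr (1 / p)"
  assumes \<kappa>: "\<kappa> = 1 / (64 * real (card C))"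
    and K: "0 < K" "8 * real n * real K \<le> m" "R \<le> m"
    and D: "finite D"
    and w: "\<And>x. x \<in> D \<Longrightarrow> 0 \<le> w x" "\<And>x. x \<in> D \<Longrightarrow> 0 \<le> w' x"
      "(\<Sum>x\<in>D. w x) = 1" "(\<Sum>x\<in>D. w' x) = 1"
    and X: "\<And>x. x \<in> D \<Longrightarrow> 0 \<le> X x \<and> X x \<le> R"
    and mom: "\<And>j. j < 2 * K \<Longrightarrow> (\<Sum>x\<in>D. w x * X x ^ j) = (\<Sum>x\<in>D. w' x * X x ^ j)"
    and mean: "(\<Sum>x\<in>D. w x * X x) \<le> 16"
    and gap: "\<tau> w - \<tau> w' \<ge> 1 / 4"
    and p: "1 \<le> p"
    and small: "m * (exp (- 3 * real K) + exp (- 8 * m / R)) \<le> 1 / 8" "exp (- m / (2 ^ 15 * R)) \<le> 1 / 16"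
  shows "\<exists>V. admissible V \<and> ennreal ((hi - lo) / 8) \<le> wasserstein_risk p n W (first_law V) (second_law V)"
proof (rule ccontr)
  assume "\<not> ?thesis"
  then have risk: "wasserstein_risk p n W (first_law V) (second_law V) < ennreal ((hi - lo) / 8)" if "admissible V" for V
    using that by (auto simp: not_le)
  have "1 \<le> real K ^ 2" using K(1) by (intro one_le_power) auto
  then have R: "1 \<le> R" by (simp add: R_def)
  have m: "0 < m" using R K(3) by linarith
  have mean': "(\<Sum>x\<in>D. w' x * X x) \<le> 16" using mom[of 1] mean K(1) by simp
  have \<tau>: "0 \<le> \<tau> u \<and> \<tau> u \<le> 17"
    if u: "\<And>x. x \<in> D \<Longrightarrow> 0 \<le> u x" "(\<Sum>x\<in>D. u x) = 1" "(\<Sum>x\<in>D. u x * X x) \<le> 16" for u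
  proof
    show "0 \<le> \<tau> u" unfolding \<tau>_def using u by (intro sum_nonneg) auto
    have "\<tau> u \<le> (\<Sum>x\<in>D. u x * (X x + 1))" unfolding \<tau>_def
      using u X by (intro sum_mono mult_left_mono) (auto simp: abs_le_iff)
    then show "\<tau> u \<le> 17" using u by (simp add: distrib_left sum.distrib)
  qed
  note \<tau>w = \<tau>[OF w(1,3) mean] and \<tau>w' = \<tau>[OF w(2,4) mean']
  have lohi: "lo < hi" unfolding lo_def hi_def
    using delta_pos gap \<tau>w \<tau>w' p by (intro mult_strict_left_mono powr_less_mono2) auto
  then have e8: "((hi - lo) / 8) / (hi - lo) = 1 / 8" by simp
  define g where "g = clamp_test lo hi W"
  have g: "0 \<le> g x \<and> g x \<le> 1" for x unfolding g_def by (rule clamp_test_bounds)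
  let ?F = "\<lambda>k. guarded_expect n g (\<lambda>i. X (k i))"
  let ?f = "\<lambda>k. \<Sum>i\<in>C. \<bar>X (k i) - 1\<bar>"
  \<comment> \<open>With \<tau> <= 17 the tail exponent is at most 17 \<sigma>^2 - \<sigma> / 16 =
    -47 / 2^20, which is below -1 / 2^15.\<close>
  define \<sigma> :: real where "\<sigma> = 1 / 1024"
  have f: "0 \<le> \<bar>X x - 1\<bar> \<and> \<bar>X x - 1\<bar> \<le> R" if "x \<in> D" for x
    using X[OF that] R by (auto simp: abs_le_iff)
  have Xk: "0 \<le> X (k i)" if "k \<in> C \<rightarrow>\<^sub>E D" "i \<in> C" for k i using that X by (auto simp: PiE_iff)
  have W: "wasserstein p (first_law (\<lambda>i. X (k i))) (second_law (\<lambda>i. X (k i))) = \<delta> * (?f k / m / 64) powr (1 / p)"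
    if "admissible (\<lambda>i. X (k i))" for k
  proof -
    have "\<kappa> * ?f k = ?f k / m / 64" by (simp add: \<kappa> m_def)
    then show ?thesis using wasserstein_laws[OF that p] by (simp only:)
  qed
  \<comment> \<open>Exponential Markov bound for both tails: the sign of s selects deviations by m /
    16 upwards or downwards, and the terms linear in s \<tau> u cancel.\<close>
  have tail: "prod_expect C D (\<lambda>_. u) (\<lambda>k. exp (s * (?f k - m * (\<tau> u + sgn s / 16)) / R)) \<le> 1 / 16"
    if u: "\<And>x. x \<in> D \<Longrightarrow> 0 \<le> u x" "(\<Sum>x\<in>D. u x) = 1" "(\<Sum>x\<in>D. u x * X x) \<le> 16" and s: "s = \<sigma> \<or> s = - \<sigma>" for u s
  proof -
    let ?c = "exp (- s * m * (\<tau> u + sgn s / 16) / R)"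
    have "prod_expect C D (\<lambda>_. u) (\<lambda>k. exp (s * (?f k - m * (\<tau> u + sgn s / 16)) / R))
       = prod_expect C D (\<lambda>_. u) (\<lambda>k. ?c * exp (s * ?f k / R))"
      by (simp flip: exp_add add_divide_distrib add: algebra_simps)
    also have "\<dots> = ?c * prod_expect C D (\<lambda>_. u) (\<lambda>k. exp (s * ?f k / R))"
      by (rule prod_expect_cmult)
    also have "\<dots> \<le> ?c * exp (real (card C) * ((s + s\<^sup>2) * (\<Sum>x\<in>D. u x * \<bar>X x - 1\<bar>) / R))"
      using R s by (intro mult_left_mono prod_expect_exp_sum_le[OF finite_C D u(1,2) f]) (auto simp: \<sigma>_def)
    also have "\<dots> = exp (m / R * (s\<^sup>2 * \<tau> u - s * sgn s / 16))"
    proof -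
      have "- s * m * (\<tau> u + sgn s / 16) / R + real (card C) * ((s + s\<^sup>2) * \<tau> u / R)
        = m / R * (s\<^sup>2 * \<tau> u - s * sgn s / 16)"
        using R by (simp add: m_def field_simps)
      then show ?thesis by (simp only: \<tau>_def exp_add[symmetric])
    qed
    also have "m / R * (s\<^sup>2 * \<tau> u - s * sgn s / 16) \<le> m / R * (- 1 / 2 ^ 15)"
    proof (intro mult_left_mono)
      have e: "s * sgn s = \<sigma>" "s\<^sup>2 = \<sigma>\<^sup>2" using s by (auto simp: \<sigma>_def)
      have "\<sigma>\<^sup>2 * \<tau> u \<le> \<sigma>\<^sup>2 * 17" using \<tau>[OF u] by (intro mult_left_mono) auto
      moreover have "\<sigma>\<^sup>2 * 17 - \<sigma> / 16 \<le> - 1 / 2 ^ 15" by (simp add: \<sigma>_def power2_eq_square)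
      ultimately show "s\<^sup>2 * \<tau> u - s * sgn s / 16 \<le> - 1 / 2 ^ 15"
        unfolding e by linarith
    qed (use m R in auto)
    also have "exp (m / R * (- 1 / 2 ^ 15)) = exp (- m / (2 ^ 15 * R))" by (simp add: mult.commute)
    finally show ?thesis using small(2) by simp
  qed
  have upper: "prod_expect C D (\<lambda>_. w') ?F \<le> 1 / 8 + 1 / 16"
  proof -
    let ?e = "\<lambda>k. exp (\<sigma> * (?f k - m * (\<tau> w' + sgn \<sigma> / 16)) / R)"
    have "prod_expect C D (\<lambda>_. w') ?F \<le> prod_expect C D (\<lambda>_. w') (\<lambda>k. 1 / 8 + ?e k)"
    proof (rule prod_expect_mono)
      fix k assume k: "k \<in> C \<rightarrow>\<^sub>E D"
      show "?F k \<le> 1 / 8 + ?e k"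
      proof (cases "?f k \<le> m * (\<tau> w' + 1 / 16)")
        case False
        then have "0 \<le> \<sigma> * (?f k - m * (\<tau> w' + sgn \<sigma> / 16)) / R" using R by (simp add: \<sigma>_def)
        then have "1 \<le> ?e k" by simp
        moreover have "?F k \<le> 1" using guarded_expect_bounds[OF \<kappa> _ g] Xk[OF k] by auto
        ultimately show ?thesis by linarith
      next
        case True
        show ?thesis
        proof (cases "(\<Sum>i\<in>C. X (k i)) \<le> 63 * real (card C)")
          case good: True
          then have adm: "admissible (\<lambda>i. X (k i))" using Xk[OF k] by (intro admissible_if_sum_le[OF \<kappa>])
          have "?f k / m / 64 \<le> (\<tau> w' + 1 / 16) / 64" using True m by (simp add: field_simps)
          then have "\<delta> * (?f k / m / 64) powr (1 / p) \<le> lo" unfolding lo_def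
            using delta_pos p m by (intro mult_left_mono powr_mono2) (auto intro!: divide_nonneg_nonneg sum_nonneg)
          then have "law_expect n (\<lambda>i. X (k i)) g \<le> ((hi - lo) / 8) / (hi - lo)"
            unfolding g_def using lohi by (intro law_expect_clamp_test(1)[OF adm lohi _ risk[OF adm]]) (auto simp: W[OF adm])
          then have "?F k \<le> 1 / 8" using good by (simp only: e8 guarded_expect_def if_True)
          moreover have "0 \<le> ?e k" by simp
          ultimately show ?thesis by linarith
        qed (simp add: guarded_expect_def add_increasing)
      qed
    qed (use w in auto)
    also have "\<dots> = 1 / 8 + prod_expect C D (\<lambda>_. w') ?e"
      using prod_expect_const[OF finite_C D, of "\<lambda>_. w'"] w by (simp add: prod_expect_add)
    also have "\<dots> \<le> 1 / 8 + 1 / 16" by (intro add_left_mono tail w mean') auto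
    finally show ?thesis .
  qed
  \<comment> \<open>A failing guard was harmless for the upper bound, as the guarded expectation is
    0 there. Here it must be paid for by \<open>?c\<close>, a bound for the event that the V sum to
    more than 63 m; the exponent -63 + 32 < 0 keeps it small.\<close>
  have lower: "7 / 8 - 1 / 16 - 1 / 16 \<le> prod_expect C D (\<lambda>_. w) ?F"
  proof -
    let ?e = "\<lambda>k. exp ((- \<sigma>) * (?f k - m * (\<tau> w + sgn (- \<sigma>) / 16)) / R)"
    let ?c = "\<lambda>k. exp (- 63 * m / R) * exp (1 * (\<Sum>i\<in>C. X (k i)) / R)"
    have "prod_expect C D (\<lambda>_. w) ?c = exp (- 63 * m / R) * prod_expect C D (\<lambda>_. w) (\<lambda>k. exp (1 * (\<Sum>i\<in>C. X (k i)) / R))"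
      by (rule prod_expect_cmult)
    also have "\<dots> \<le> exp (- 63 * m / R) * exp (real (card C) * ((1 + 1\<^sup>2) * (\<Sum>x\<in>D. w x * X x) / R))"
      using R by (intro mult_left_mono prod_expect_exp_sum_le[OF finite_C D w(1,3) X]) auto
    also have "\<dots> \<le> exp (- 63 * m / R) * exp (m * (2 * 16 / R))"
      using mean R m by (intro mult_left_mono) (auto simp: m_def intro!: mult_left_mono divide_right_mono)
    also have "\<dots> \<le> exp (- m / (2 ^ 15 * R))"
      using m R by (simp flip: exp_add add: field_simps)
    finally have c: "prod_expect C D (\<lambda>_. w) ?c \<le> 1 / 16" using small(2) by simp
    have "7 / 8 - 1 / 16 - 1 / 16 \<le> 7 / 8 - prod_expect C D (\<lambda>_. w) ?e - prod_expect C D (\<lambda>_. w) ?c"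
      using c tail[OF w(1,3) mean, of "- \<sigma>"] by simp
    also have "\<dots> = prod_expect C D (\<lambda>_. w) (\<lambda>k. 7 / 8 - ?e k - ?c k)"
      using prod_expect_const[OF finite_C D, of "\<lambda>_. w"] w by (simp add: prod_expect_diff)
    also have "\<dots> \<le> prod_expect C D (\<lambda>_. w) ?F"
    proof (rule prod_expect_mono)
      fix k assume k: "k \<in> C \<rightarrow>\<^sub>E D"
      have F0: "0 \<le> ?F k" using guarded_expect_bounds[OF \<kappa> _ g] Xk[OF k] by auto
      have pos: "0 \<le> ?e k" "0 \<le> ?c k" by simp_all
      show "7 / 8 - ?e k - ?c k \<le> ?F k"
      proof (cases "m * (\<tau> w - 1 / 16) \<le> ?f k")
        case False
        then have "0 \<le> (- \<sigma>) * (?f k - m * (\<tau> w + sgn (- \<sigma>) / 16)) / R" using R by (simp add: \<sigma>_def divide_le_0_iff)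
        then have "1 \<le> ?e k" by simp
        then show ?thesis using F0 pos by linarith
      next
        case True
        show ?thesis
        proof (cases "(\<Sum>i\<in>C. X (k i)) \<le> 63 * real (card C)")
          case good: True
          then have adm: "admissible (\<lambda>i. X (k i))" using Xk[OF k] by (intro admissible_if_sum_le[OF \<kappa>])
          have "(\<tau> w - 1 / 16) / 64 \<le> ?f k / m / 64" using True m by (simp add: field_simps)
          then have "hi \<le> \<delta> * (?f k / m / 64) powr (1 / p)" unfolding hi_def
            using delta_pos p gap \<tau>w' by (intro mult_left_mono powr_mono2) auto
          then have "1 - ((hi - lo) / 8) / (hi - lo) \<le> law_expect n (\<lambda>i. X (k i)) g"
            unfolding g_def using lohi by (intro law_expect_clamp_test(2)[OF adm lohi _ risk[OF adm]]) (auto simp: W[OF adm])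
          then have "1 - 1 / 8 \<le> ?F k" using good by (simp only: e8 guarded_expect_def if_True)
          then show ?thesis using pos by linarith
        next
          case False
          then have "1 \<le> ?c k" using R by (simp flip: exp_add add: field_simps m_def)
          then show ?thesis using F0 pos by linarith
        qed
      qed
    qed (use w in auto)
    finally show ?thesis .
  qed
  have "\<bar>prod_expect C D (\<lambda>_. w) ?F - prod_expect C D (\<lambda>_. w') ?F\<bar> \<le> 1 / 8"
  proof -
    have "\<bar>prod_expect C D (\<lambda>_. w) ?F - prod_expect C D (\<lambda>_. w') ?F\<bar> \<le> real (card C) *
      (exp (- 3 * real K) + exp (- 8 * real (card C) / (16 * real K ^ 2)))"
      by (rule guarded_expect_indistinguishable[OF \<kappa> K(1) K(2,3)[unfolded m_def R_def] D w X[unfolded R_def] mom mean g])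
    then show ?thesis using small(1) unfolding m_def R_def by linarith
  qed
  with upper lower show False by linarith
qed

end

context paired_cells
begin

text \<open>At V = 1 both laws coincide and the distance is 0. A perturbation of mass of order
  n^(-1/2) is statistically invisible, but the p-th root turns it into a distance of order
  n^(-1/(2p)).\<close>

lemma two_point_lower_bound:
  assumes C: "C = {i}" and \<kappa>: "\<kappa> = 1 / 4" and n: "1 \<le> n" and p: "1 \<le> p"
  defines "\<epsilon> \<equiv> 1 / (2 * sqrt (real n))"
  shows "\<exists>V. admissible V \<and> ennreal (\<delta> * (\<epsilon> / 4) powr (1 / p) / 8) \<le> wasserstein_risk p n W (first_law V) (second_law V)"
proof (rule ccontr)
  assume "\<not> ?thesis"
  then have risk: "wasserstein_risk p n W (first_law V) (second_law V) < ennreal (\<delta> * (\<epsilon> / 4) powr (1 / p) / 8)"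
    if "admissible V" for V using that by (auto simp: not_le)
  have sq: "1 \<le> sqrt (real n)" using n by simp
  have "1 \<le> 2 * sqrt (real n)" using sq by linarith
  then have \<epsilon>: "0 < \<epsilon>" "\<epsilon> \<le> 1" unfolding \<epsilon>_def using n by (simp_all add: divide_le_eq_1)
  have n\<epsilon>: "real n * \<epsilon>\<^sup>2 = 1 / 4" using n by (simp add: \<epsilon>_def power_divide power_mult_distrib)
  define V0 V1 :: "'c \<Rightarrow> real" where "V0 = (\<lambda>_. 1)" and "V1 = (\<lambda>_. 1 + \<epsilon>)"
  have adm: "admissible V0" "admissible V1" unfolding admissible_def using \<epsilon> by (auto simp: V0_def V1_def C \<kappa>)
  define hi where "hi = \<delta> * (\<epsilon> / 4) powr (1 / p)"
  have hi: "0 < hi" using delta_pos \<epsilon> by (simp add: hi_def)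
  have W: "wasserstein p (first_law V0) (second_law V0) = 0" "wasserstein p (first_law V1) (second_law V1) = hi"
    using wasserstein_laws[OF _ p] adm \<epsilon> by (simp_all add: V0_def V1_def C \<kappa> hi_def)
  define g where "g = clamp_test 0 hi W"
  have g: "\<bar>g x\<bar> \<le> 1" for x using clamp_test_bounds[of 0 hi W x] by (simp add: g_def)
  have "law_expect n V0 g \<le> (hi / 8) / (hi - 0)" unfolding g_def
    by (rule law_expect_clamp_test(1)[OF adm(1) hi _ risk[OF adm(1), folded hi_def]]) (use W hi in auto)
  moreover have "1 - (hi / 8) / (hi - 0) \<le> law_expect n V1 g" unfolding g_def
    by (rule law_expect_clamp_test(2)[OF adm(2) hi _ risk[OF adm(2), folded hi_def]]) (use W hi in auto)
  ultimately have sep: "3 / 4 \<le> law_expect n V1 g - law_expect n V0 g" using hi by simp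
  have ne: "a i \<noteq> b i" "a i \<noteq> z" "b i \<noteq> z" using distinct_points C by auto
  have pts: "points = {z, a i, b i}" unfolding points_def by (auto simp: C)
  have m: "mass a b V {z} = 1 - (1 + V i) / 4" "mass a b V {a i} = V i / 4" "mass a b V {b i} = 1 / 4"
    "mass b a V {z} = 1 - (1 + V i) / 4" "mass b a V {b i} = V i / 4" "mass b a V {a i} = 1 / 4" for V
    unfolding mass_def using ne ne[symmetric] by (auto simp: C \<kappa>)
  \<comment> \<open>The reference masses are 1/2 at z and 1/4 at the two other points; the terms
    linear in \<epsilon> cancel.\<close>
  have chi: "(\<Sum>x\<in>points. (mass a b V1 {x})\<^sup>2 / mass a b V0 {x}) = 1 + 3 * \<epsilon>\<^sup>2 / 8"
    "(\<Sum>x\<in>points. (mass b a V1 {x})\<^sup>2 / mass b a V0 {x}) = 1 + 3 * \<epsilon>\<^sup>2 / 8"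
    using ne ne[symmetric] unfolding pts by (simp_all add: m V0_def V1_def power2_eq_square field_simps)
  \<comment> \<open>Separation requires 144/256, but n \<epsilon>^2 = 1/4 allows at most 3/16 +
    (3/16)^2 = 57/256.\<close>
  have "(3 / 4)\<^sup>2 \<le> (law_expect n V1 g - law_expect n V0 g)\<^sup>2" using sep by (intro power_mono) auto
  also have "\<dots> \<le> (1 + 3 * \<epsilon>\<^sup>2 / 8) ^ n * (1 + 3 * \<epsilon>\<^sup>2 / 8) ^ n - 1"
  proof -
    have "0 < mass a b V0 {x}" "0 < mass b a V0 {x}" if "x \<in> points" for x
      using that unfolding pts by (auto simp: m V0_def)
    then have "(law_expect n V1 g - law_expect n V0 g)\<^sup>2 \<le>
        (\<Sum>x\<in>points. (mass a b V1 {x})\<^sup>2 / mass a b V0 {x}) ^ n * (\<Sum>x\<in>points. (mass b a V1 {x})\<^sup>2 / mass b a V0 {x}) ^ n - 1"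
      by (intro law_expect_chi_square g)
    then show ?thesis unfolding chi .
  qed
  also have "(1 + 3 * \<epsilon>\<^sup>2 / 8) ^ n \<le> exp (3 * \<epsilon>\<^sup>2 / 8) ^ n"
    by (intro power_mono exp_ge_add_one_self) auto
  then have "(1 + 3 * \<epsilon>\<^sup>2 / 8) ^ n * (1 + 3 * \<epsilon>\<^sup>2 / 8) ^ n - 1 \<le> exp (3 * \<epsilon>\<^sup>2 / 8) ^ n * exp (3 * \<epsilon>\<^sup>2 / 8) ^ n - 1"
    by (intro diff_right_mono mult_mono) auto
  also have "\<dots> = exp (3 / 4 * (real n * \<epsilon>\<^sup>2)) - 1"
    by (simp flip: exp_of_nat_mult exp_add)
  also have "\<dots> \<le> (3 / 16) + (3 / 16)\<^sup>2"
    unfolding n\<epsilon> using exp_bound[of "3 / 16 :: real"] by simp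
  finally show False by (simp add: power2_eq_square)
qed

end

section \<open>Placing the pairs on a lattice in the unit cube\<close>

definition grid_point :: "nat \<Rightarrow> ('d \<Rightarrow> nat) \<Rightarrow> real ^ 'd" where
  "grid_point q u = (\<chi> i. real (u i) / real (2 * q))"

definition grid_cells :: "nat \<Rightarrow> ('d \<Rightarrow> nat) set" where
  "grid_cells q = {f. \<forall>i. f i < q}"

lemma grid_cells_eq_PiE: "grid_cells q = PiE UNIV (\<lambda>_. {..<q})"
  by (auto simp: grid_cells_def PiE_UNIV_domain)

lemma finite_grid_cells: "finite (grid_cells q :: ('d::finite \<Rightarrow> nat) set)"
  unfolding grid_cells_eq_PiE by (intro finite_PiE) auto

lemma card_grid_cells: "card (grid_cells q :: ('d::finite \<Rightarrow> nat) set) = q ^ CARD('d)"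
  unfolding grid_cells_eq_PiE by (subst card_PiE) auto

lemma grid_point_separated:
  assumes "0 < q" "u \<noteq> v"
  shows "1 / real (2 * q) \<le> norm (grid_point q u - grid_point q v :: real ^ 'd)"
proof -
  obtain i where i: "u i \<noteq> v i" using assms(2) by auto
  have "1 \<le> \<bar>real (u i) - real (v i)\<bar>" using i by linarith
  then have "1 / real (2 * q) \<le> \<bar>real (u i) - real (v i)\<bar> / real (2 * q)" by (intro divide_right_mono) auto
  also have "\<dots> = \<bar>(grid_point q u - grid_point q v :: real ^ 'd) $ i\<bar>"
    by (simp add: grid_point_def abs_divide flip: diff_divide_distrib)
  also have "\<dots> \<le> norm (grid_point q u - grid_point q v :: real ^ 'd)" by (rule component_le_norm_cart)
  finally show ?thesis .
qed

lemma grid_point_inject: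
  assumes "0 < q"
  shows "grid_point q u = (grid_point q v :: real ^ 'd) \<longleftrightarrow> u = v"
proof
  assume e: "grid_point q u = (grid_point q v :: real ^ 'd)"
  show "u = v"
  proof (rule ccontr)
    assume "u \<noteq> v"
    from grid_point_separated[OF assms this] e assms show False by simp
  qed
qed simp

text \<open>All points lie on the lattice of mesh 1 / (2q), which gives the separation. The lattice
  indices of a f are even and that of b f in direction e is odd, so parity separates them from each
  other and b f from the corner z = (1, ..., 1); a f differs from z because f e < q.\<close>

lemma paired_cells_grid:
  fixes e :: "'d::finite"
  assumes q: "0 < q" and \<kappa>: "0 < \<kappa>"
  defines "a \<equiv> \<lambda>f :: 'd \<Rightarrow> nat. grid_point q (\<lambda>i. 2 * f i)"
    and "b \<equiv> \<lambda>f :: 'd \<Rightarrow> nat. grid_point q (\<lambda>i. 2 * f i + (if i = e then 1 else 0))"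
    and "z \<equiv> grid_point q (\<lambda>_ :: 'd. 2 * q)"
  shows "paired_cells (grid_cells q) a b z (1 / real (2 * q)) \<kappa>"
proof -
  let ?U = "{u :: 'd \<Rightarrow> nat. \<forall>i. u i \<le> 2 * q}"
  have sub: "insert z (a ` grid_cells q \<union> b ` grid_cells q) \<subseteq> grid_point q ` ?U"
  proof -
    have "2 * f i + (if i = e then 1 else 0) \<le> 2 * q" "2 * f i \<le> 2 * q" if "f \<in> grid_cells q" for f i
    proof -
      have "f i < q" using that by (simp add: grid_cells_def)
      then show "2 * f i + (if i = e then 1 else 0) \<le> 2 * q" "2 * f i \<le> 2 * q" by auto
    qed
    then show ?thesis by (auto simp: a_def b_def z_def)
  qed
  show ?thesis
  proof
    show "finite (grid_cells q :: ('d \<Rightarrow> nat) set)" by (rule finite_grid_cells)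
    show "0 < 1 / real (2 * q)" "0 < \<kappa>" using q \<kappa> by auto
    show "inj_on a (grid_cells q)"
      by (rule inj_onI) (auto simp: a_def grid_point_inject[OF q] fun_eq_iff)
    show "inj_on b (grid_cells q)"
      by (rule inj_onI) (auto simp: b_def grid_point_inject[OF q] fun_eq_iff)
    show "a f \<noteq> b f'" for f f'
    proof
      assume "a f = b f'"
      then have "2 * f e = 2 * f' e + 1" by (auto simp: a_def b_def grid_point_inject[OF q] dest: fun_cong[of _ _ e])
      then show False by presburger
    qed
    show "a f \<noteq> z" if "f \<in> grid_cells q" for f
    proof
      assume "a f = z"
      then have "2 * f e = 2 * q" by (auto simp: a_def z_def grid_point_inject[OF q] dest: fun_cong[of _ _ e])
      then show False using that by (auto simp: grid_cells_def)
    qed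
    show "b f \<noteq> z" for f
    proof
      assume "b f = z"
      then have "2 * f e + 1 = 2 * q" by (auto simp: b_def z_def grid_point_inject[OF q] dest: fun_cong[of _ _ e])
      then show False by presburger
    qed
    show "norm (a f - b f) = 1 / real (2 * q)" for f
    proof -
      have "a f - b f = (- 1 / real (2 * q)) *\<^sub>R axis e 1"
        using q by (auto simp: a_def b_def grid_point_def axis_def vec_eq_iff field_simps)
      then show ?thesis by simp
    qed
    show "1 / real (2 * q) \<le> norm (x - y)"
      if xy: "x \<in> insert z (a ` grid_cells q \<union> b ` grid_cells q)" "y \<in> insert z (a ` grid_cells q \<union> b ` grid_cells q)" "x \<noteq> y" for x y
    proof -
      obtain u v where "x = grid_point q u" "y = grid_point q v"
        using subsetD[OF sub xy(1)] subsetD[OF sub xy(2)] by blast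
      then show ?thesis using xy(3) grid_point_separated[OF q, of u v] by auto
    qed
    show "insert z (a ` grid_cells q \<union> b ` grid_cells q) \<subseteq> unit_cube"
    proof
      fix x assume "x \<in> insert z (a ` grid_cells q \<union> b ` grid_cells q)"
      from subsetD[OF sub this] obtain u where u: "x = grid_point q u" "\<And>i. u i \<le> 2 * q" by blast
      have "real (u i) \<le> real (2 * q)" for i using u(2) by (simp only: of_nat_le_iff)
      then show "x \<in> unit_cube" using q by (auto simp: unit_cube_def u(1) grid_point_def)
    qed
  qed
qed

text \<open>One cell, in any dimension; for d > 2p it covers the finitely many small n. The factor
  1/16 is \<delta> / 8 with \<delta> = 1/2.\<close>

lemma small_rate_lower_bound:
  fixes p :: real
  assumes p: "1 \<le> p" and n: "1 \<le> n"
  shows "\<exists>\<mu>\<in>prob_measures_on unit_cube. \<exists>\<nu>\<in>prob_measures_on (unit_cube :: (real ^ 'd) set).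
     ennreal ((1 / 8) powr (1 / p) / 16 * real n powr (- 1 / (2 * p))) \<le> wasserstein_risk p n W \<mu> \<nu>"
proof -
  let ?e = "undefined :: 'd"
  interpret paired_cells "grid_cells 1" "\<lambda>f. grid_point 1 (\<lambda>i. 2 * f i)"
    "\<lambda>f. grid_point 1 (\<lambda>i. 2 * f i + (if i = ?e then 1 else 0))" "grid_point 1 (\<lambda>_ :: 'd. 2 * 1)" "1 / real (2 * 1)" "1 / 4"
    by (rule paired_cells_grid) auto
  have "grid_cells 1 = {\<lambda>_ :: 'd. 0}" by (auto simp: grid_cells_def)
  from two_point_lower_bound[OF this refl n p, of W]
  obtain V where V: "admissible V"
    "ennreal (1 / real (2 * 1) * (1 / (2 * sqrt (real n)) / 4) powr (1 / p) / 8) \<le> wasserstein_risk p n W (first_law V) (second_law V)"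
    by blast
  have "1 / (2 * sqrt (real n)) / 4 = (1 / 8) * real n powr (- 1 / 2)"
    using n by (simp add: powr_minus powr_half_sqrt field_simps)
  moreover have "((1 / 8) * real n powr (- 1 / 2)) powr (1 / p) = (1 / 8) powr (1 / p) * real n powr (- 1 / (2 * p))"
    by (subst powr_mult) (simp_all add: powr_powr)
  ultimately have "(1 / (2 * sqrt (real n)) / 4) powr (1 / p) = (1 / 8) powr (1 / p) * real n powr (- 1 / (2 * p))"
    by (simp only:)
  with V(2) have "ennreal ((1 / 8) powr (1 / p) / 16 * real n powr (- 1 / (2 * p))) \<le> wasserstein_risk p n W (first_law V) (second_law V)"
    by simp
  then show ?thesis using laws_in_prob_measures_on[OF V(1)] by blast
qed

section \<open>The lower bound\<close>

text \<open>Mean value theorem: on (0, 1] the p-th root has slope at least 1 / p. This transfers a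
  gap in transported mass to a gap in distance.\<close>

lemma powr_root_gap:
  fixes p x y :: real
  assumes "1 \<le> p" "0 < x" "x < y" "y \<le> 1"
  shows "(y - x) / p \<le> y powr (1 / p) - x powr (1 / p)"
proof -
  have "\<exists>\<xi>>x. \<xi> < y \<and> y powr (1 / p) - x powr (1 / p) = (y - x) * (1 / p * \<xi> powr (1 / p - 1))"
    using assms(3)
  proof (rule MVT2)
    show "((\<lambda>x. x powr (1 / p)) has_real_derivative 1 / p * \<xi> powr (1 / p - 1)) (at \<xi>)" if "x \<le> \<xi>" "\<xi> \<le> y" for \<xi>
      using that assms(2) by (intro has_real_derivative_powr) simp
  qed
  then obtain \<xi> where \<xi>: "x < \<xi>" "\<xi> < y" "y powr (1 / p) - x powr (1 / p) = (y - x) * (1 / p * \<xi> powr (1 / p - 1))"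
    by blast
  have "\<xi> powr 0 \<le> \<xi> powr (1 / p - 1)" using assms \<xi> by (intro powr_mono') auto
  then have "1 / p \<le> 1 / p * \<xi> powr (1 / p - 1)" using assms \<xi> by (simp add: divide_right_mono)
  then have "(y - x) * (1 / p) \<le> (y - x) * (1 / p * \<xi> powr (1 / p - 1))"
    using assms by (intro mult_left_mono) auto
  then show ?thesis unfolding \<xi>(3) by simp
qed

lemma exp_minus_le_inverse_square:
  fixes y :: real
  assumes "0 < y"
  shows "exp (- y) \<le> 2 / y\<^sup>2"
proof -
  have "y\<^sup>2 / 2 \<le> exp y" using exp_lower_Taylor_quadratic[of y] assms by simp
  then show ?thesis using assms by (simp add: exp_minus field_simps)
qed

text \<open>K is ln n rounded up and m = q^d lies between 8 n K and 2^d times that; L bounds K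
  without rounding. E1 gives R <= m, and E2, E3, E4 control the three error terms of
  \<open>minimax_contradiction\<close>.\<close>

lemma log_rate_lower_bound_at:
  fixes p :: real and n :: nat and W :: "(nat \<Rightarrow> real ^ 'd) \<times> (nat \<Rightarrow> real ^ 'd) \<Rightarrow> real"
  defines "d \<equiv> CARD('d)" and "L \<equiv> ln (real n) + 1"
  assumes p: "1 \<le> p"
    and E1: "2 * L \<le> real n" and E2: "2 ^ d * 8 * L / real n ^ 2 \<le> 1 / 16"
    and E3: "L ^ 3 / real n \<le> 1 / 16" and E4: "exp (- real n / (2 ^ 16 * L)) \<le> 1 / 16"
    and E5: "1 \<le> ln (real n)"
  shows "\<exists>\<mu>\<in>prob_measures_on unit_cube. \<exists>\<nu>\<in>prob_measures_on unit_cube.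
     ennreal (1 / (262144 * p) * (real n * ln (real n)) powr (- 1 / real d)) \<le> wasserstein_risk p n W \<mu> \<nu>"
proof -
  have n: "0 < real n" using E1 E5 by (simp add: L_def)
  have d: "0 < d" by (simp add: d_def)
  define K where "K = nat \<lceil>ln (real n)\<rceil>"
  have K: "ln (real n) \<le> real K" "real K \<le> L" "0 < K" using E5 unfolding K_def L_def by linarith+
  have K1: "1 \<le> real K" using K(3) by simp
  have L: "L \<le> 2 * ln (real n)" using E5 by (simp add: L_def)
  define t where "t = (8 * real n * real K) powr (1 / real d)"
  have nK: "1 \<le> 8 * real n * real K"
  proof -
    have "1 * 1 \<le> (8 * real n) * real K" using E1 E5 K1 by (intro mult_mono) (auto simp: L_def)
    then show ?thesis by simp
  qed
  have t: "1 \<le> t" unfolding t_def using nK by (intro ge_one_powr_ge_zero) auto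
  have td: "t ^ d = 8 * real n * real K"
  proof -
    have "t ^ d = t powr real d" using t by (simp add: powr_realpow)
    also have "\<dots> = 8 * real n * real K" using nK d by (simp add: t_def powr_powr)
    finally show ?thesis .
  qed
  define q where "q = nat \<lceil>t\<rceil>"
  have q: "t \<le> real q" "real q \<le> 2 * t" "0 < q" using t unfolding q_def by linarith+
  let ?e = "undefined :: 'd" and ?C = "grid_cells q :: ('d \<Rightarrow> nat) set"
  let ?\<kappa> = "1 / (64 * real (card ?C))"
  have card: "card ?C = q ^ d" by (simp add: card_grid_cells d_def)
  interpret paired_cells ?C "\<lambda>f. grid_point q (\<lambda>i. 2 * f i)"
    "\<lambda>f. grid_point q (\<lambda>i. 2 * f i + (if i = ?e then 1 else 0))" "grid_point q (\<lambda>_. 2 * q)" "1 / real (2 * q)" ?\<kappa>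
    using q(3) by (intro paired_cells_grid) (auto simp: card)
  let ?m = "real (card ?C)" and ?R = "16 * real K ^ 2"
  have m: "8 * real n * real K \<le> ?m" "?m \<le> 2 ^ d * (8 * real n * real K)"
    using power_mono[OF q(1), of d] power_mono[OF q(2), of d] t
    by (simp_all add: card td power_mult_distrib)
  have m0: "0 < ?m" using m(1) nK by linarith
  have R0: "0 < ?R" using K1 by simp
  have "?R = (16 * real K) * real K" by (simp add: power2_eq_square)
  also have "\<dots> \<le> (8 * real n) * real K" using E1 K by (intro mult_right_mono) auto
  also note m(1)
  finally have Rm: "?R \<le> ?m" .
  \<comment> \<open>The factor exp (- 3 K) <= n^(-3) outweighs m, which is of order n ln n.\<close>
  have s1: "?m * exp (- 3 * real K) \<le> 1 / 16"
  proof -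
    have "exp (- 3 * real K) \<le> exp (- 3 * ln (real n))" using K by simp
    also have "\<dots> = 1 / real n ^ 3"
      using n exp_of_nat_mult[of 3 "ln (real n)"] by (simp add: exp_minus inverse_eq_divide)
    finally have "?m * exp (- 3 * real K) \<le> (2 ^ d * (8 * real n * L)) * (1 / real n ^ 3)"
      using m(2) K n m0 by (intro mult_mono order.trans[OF m(2)]) auto
    also have "\<dots> = 2 ^ d * 8 * L / real n ^ 2" using n by (simp add: field_simps eval_nat_numeral)
    finally show ?thesis using E2 by linarith
  qed
  have s2: "?m * exp (- 8 * ?m / ?R) \<le> 1 / 16"
  proof -
    \<comment> \<open>An inverse square already absorbs the factor m, leaving a multiple of K^4 /
      m.\<close>
    have "?m * exp (- (8 * ?m / ?R)) \<le> ?m * (2 / (8 * ?m / ?R)\<^sup>2)"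
      using m0 R0 by (intro mult_left_mono exp_minus_le_inverse_square) auto
    also have "\<dots> = 8 * real K ^ 4 / ?m" using m0 K1 by (simp add: field_simps eval_nat_numeral)
    also have "\<dots> \<le> 8 * real K ^ 4 / (8 * real n * real K)" using m m0 n K by (intro divide_left_mono mult_pos_pos) auto
    also have "\<dots> = real K ^ 3 / real n" using K1 by (simp add: field_simps eval_nat_numeral)
    also have "\<dots> \<le> L ^ 3 / real n" using K n by (intro divide_right_mono power_mono) auto
    also note E3
    finally show ?thesis by simp
  qed
  have s3: "exp (- ?m / (2 ^ 15 * ?R)) \<le> 1 / 16"
  proof -
    have "real n / (2 ^ 16 * L) \<le> real n / (2 ^ 16 * real K)" using K K1 n by (intro divide_left_mono) auto
    also have "\<dots> = (8 * real n * real K) / (2 ^ 15 * ?R)" using K1 by (simp add: field_simps power2_eq_square)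
    also have "\<dots> \<le> ?m / (2 ^ 15 * ?R)" using m R0 by (intro divide_right_mono) auto
    finally have "exp (- ?m / (2 ^ 15 * ?R)) \<le> exp (- real n / (2 ^ 16 * L))" by simp
    then show ?thesis using E4 by linarith
  qed
  obtain w w' X :: "nat \<Rightarrow> real" where wX:
    "\<And>k. k < 8 * K \<Longrightarrow> 0 \<le> X k \<and> X k \<le> 16 * real K ^ 2"
    "\<And>k. w k \<ge> 0" "\<And>k. w' k \<ge> 0" "(\<Sum>k<8*K. w k) = 1" "(\<Sum>k<8*K. w' k) = 1"
    "\<And>j. j < 2 * K \<Longrightarrow> (\<Sum>k<8*K. w k * X k ^ j) = (\<Sum>k<8*K. w' k * X k ^ j)"
    "(\<Sum>k<8*K. w k * X k) \<le> 16"
    "(\<Sum>k<8*K. w k * \<bar>X k - 1\<bar>) - (\<Sum>k<8*K. w' k * \<bar>X k - 1\<bar>) \<ge> 1/4"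
    by (rule moment_matching_weights[OF K(3)]) (rule that, assumption+)
  define \<tau> where "\<tau> u = (\<Sum>k<8*K. u k * \<bar>X k - 1\<bar>)" for u :: "nat \<Rightarrow> real"
  have "\<exists>V. admissible V \<and> ennreal ((1 / real (2 * q) * ((\<tau> w - 1 / 16) / 64) powr (1 / p)
      - 1 / real (2 * q) * ((\<tau> w' + 1 / 16) / 64) powr (1 / p)) / 8) \<le> wasserstein_risk p n W (first_law V) (second_law V)"
    unfolding \<tau>_def
    by (rule minimax_contradiction[OF refl K(3) m(1) Rm finite_lessThan _ _ wX(4,5) _ wX(6,7,8) p])
      (use wX(1-3) s1 s2 s3 in \<open>auto simp: distrib_left\<close>)
  then obtain V where V: "admissible V" "ennreal ((1 / real (2 * q) * ((\<tau> w - 1 / 16) / 64) powr (1 / p)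
      - 1 / real (2 * q) * ((\<tau> w' + 1 / 16) / 64) powr (1 / p)) / 8) \<le> wasserstein_risk p n W (first_law V) (second_law V)"
    by blast
  have "\<tau> w \<le> (\<Sum>k<8*K. w k * (X k + 1))" unfolding \<tau>_def
    using wX by (intro sum_mono mult_left_mono) (auto simp: abs_le_iff)
  then have \<tau>w: "\<tau> w \<le> 17" using wX by (simp add: distrib_left sum.distrib)
  have \<tau>w': "0 \<le> \<tau> w'" unfolding \<tau>_def using wX by (intro sum_nonneg mult_nonneg_nonneg) auto
  have gap: "\<tau> w - \<tau> w' \<ge> 1 / 4" using wX(8) by (simp add: \<tau>_def)
  \<comment> \<open>Here 1/512 = (1/4 - 2/16) / 64; the factors 2q and 8 then give 8192 = 512 *
    16.\<close>
  have "1 / 512 / p \<le> ((\<tau> w - 1 / 16) / 64 - (\<tau> w' + 1 / 16) / 64) / p"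
  proof (intro divide_right_mono)
    have "(\<tau> w - 1 / 16) / 64 - (\<tau> w' + 1 / 16) / 64 = (\<tau> w - \<tau> w' - 1 / 8) / 64"
      by (simp add: diff_divide_distrib add_divide_distrib)
    also have "1 / 512 \<le> (\<tau> w - \<tau> w' - 1 / 8) / 64" using gap by simp
    finally show "1 / 512 \<le> (\<tau> w - 1 / 16) / 64 - (\<tau> w' + 1 / 16) / 64" .
  qed (use p in simp)
  also have "\<dots> \<le> ((\<tau> w - 1 / 16) / 64) powr (1 / p) - ((\<tau> w' + 1 / 16) / 64) powr (1 / p)"
    using \<tau>w \<tau>w' gap p by (intro powr_root_gap) auto
  finally have "1 / real (2 * q) * (1 / 512 / p) \<le> 1 / real (2 * q) *
     (((\<tau> w - 1 / 16) / 64) powr (1 / p) - ((\<tau> w' + 1 / 16) / 64) powr (1 / p))"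
    by (intro mult_left_mono) auto
  then have "1 / (8192 * p * real q) \<le> (1 / real (2 * q) * ((\<tau> w - 1 / 16) / 64) powr (1 / p)
      - 1 / real (2 * q) * ((\<tau> w' + 1 / 16) / 64) powr (1 / p)) / 8"
    by (simp add: right_diff_distrib mult.commute)
  \<comment> \<open>262144 = 8192 * 32, from q <= 2 t and t <= 16 (n ln n)^(1/d).\<close>
  moreover have "1 / (262144 * p) * (real n * ln (real n)) powr (- 1 / real d) \<le> 1 / (8192 * p * real q)"
  proof -
    have nl: "0 < real n * ln (real n)" using n E5 by (intro mult_pos_pos) linarith+
    have "8 * real n * real K \<le> 16 * (real n * ln (real n))"
      using K L n by (simp add: mult.left_commute)
    then have "t \<le> (16 * (real n * ln (real n))) powr (1 / real d)"
      unfolding t_def using nK by (intro powr_mono2) auto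
    also have "\<dots> = 16 powr (1 / real d) * (real n * ln (real n)) powr (1 / real d)"
      using nl by (intro powr_mult)
    also have "\<dots> \<le> 16 powr 1 * (real n * ln (real n)) powr (1 / real d)"
      using d by (intro mult_right_mono powr_mono) auto
    finally have "real q \<le> 32 * (real n * ln (real n)) powr (1 / real d)" using q(2) by simp
    then have "8192 * p * real q \<le> 8192 * p * (32 * (real n * ln (real n)) powr (1 / real d))"
      using p by (intro mult_left_mono) auto
    then have "1 / (8192 * p * (32 * (real n * ln (real n)) powr (1 / real d))) \<le> 1 / (8192 * p * real q)"
      using p q(3) n E5 by (intro divide_left_mono) (auto intro!: mult_pos_pos)
    then show ?thesis by (simp add: powr_minus field_simps)
  qed
  ultimately have "ennreal (1 / (262144 * p) * (real n * ln (real n)) powr (- 1 / real d)) \<le>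
     wasserstein_risk p n W (first_law V) (second_law V)"
    by (intro order.trans[OF ennreal_leI V(2)]) linarith
  then show ?thesis using laws_in_prob_measures_on[OF V(1)] by blast
qed

lemma log_rate_lower_bound:
  fixes p :: real
  assumes "1 \<le> p"
  shows "\<exists>n0. \<forall>n\<ge>n0. \<forall>W :: (nat \<Rightarrow> real ^ 'd) \<times> (nat \<Rightarrow> real ^ 'd) \<Rightarrow> real.
     \<exists>\<mu>\<in>prob_measures_on unit_cube. \<exists>\<nu>\<in>prob_measures_on unit_cube.
       ennreal (1 / (262144 * p) * (real n * ln (real n)) powr (- 1 / real CARD('d))) \<le> wasserstein_risk p n W \<mu> \<nu>"
proof -
  have "eventually (\<lambda>n. 2 * (ln (real n) + 1) \<le> real n) at_top"
    "eventually (\<lambda>n. c * 8 * (ln (real n) + 1) / real n ^ 2 \<le> 1 / 16) at_top"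
    "eventually (\<lambda>n. (ln (real n) + 1) ^ 3 / real n \<le> 1 / 16) at_top"
    "eventually (\<lambda>n. exp (- real n / (2 ^ 16 * (ln (real n) + 1))) \<le> 1 / 16) at_top"
    "eventually (\<lambda>n. 1 \<le> ln (real n)) at_top" for c :: real
    by real_asymp+
  then have "eventually (\<lambda>n. \<forall>W :: (nat \<Rightarrow> real ^ 'd) \<times> (nat \<Rightarrow> real ^ 'd) \<Rightarrow> real.
     \<exists>\<mu>\<in>prob_measures_on unit_cube. \<exists>\<nu>\<in>prob_measures_on unit_cube.
       ennreal (1 / (262144 * p) * (real n * ln (real n)) powr (- 1 / real CARD('d))) \<le> wasserstein_risk p n W \<mu> \<nu>) at_top"
    by eventually_elim (use log_rate_lower_bound_at[OF assms] in blast)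
  then show ?thesis unfolding eventually_sequentially .
qed

theorem theorem3:
  fixes p :: real
  assumes "p \<ge> 1"
  shows "\<exists>c>0. \<forall>n\<ge>2.
    \<forall>W \<in> (estimators n :: ((nat \<Rightarrow> real ^ 'd) \<times> (nat \<Rightarrow> real ^ 'd) \<Rightarrow> real) set).
      \<exists>\<mu>\<in>prob_measures_on unit_cube. \<exists>\<nu>\<in>prob_measures_on unit_cube.
        wasserstein_risk p n W \<mu> \<nu> \<ge> ennreal (lower_rate c p CARD('d) n)"
proof (cases "real CARD('d) \<le> 2 * p")
  case True
  show ?thesis
  proof (intro exI[of _ "(1 / 8) powr (1 / p) / 16"] conjI allI impI ballI)
    show "0 < (1 / 8) powr (1 / p) / (16 :: real)" by simp
    show "\<exists>\<mu>\<in>prob_measures_on unit_cube. \<exists>\<nu>\<in>prob_measures_on (unit_cube :: (real ^ 'd) set).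
        ennreal (lower_rate ((1 / 8) powr (1 / p) / 16) p CARD('d) n) \<le> wasserstein_risk p n W \<mu> \<nu>"
      if "2 \<le> n" for n W
      using small_rate_lower_bound[OF assms, of n W] that True by (simp add: lower_rate_def)
  qed
next
  case False
  define c1 where "c1 = (1 / 8) powr (1 / p) / (16 :: real)"
  define c2 where "c2 = 1 / (262144 * p)"
  obtain n0 where n0: "\<And>n W. n0 \<le> n \<Longrightarrow> \<exists>\<mu>\<in>prob_measures_on unit_cube. \<exists>\<nu>\<in>prob_measures_on (unit_cube :: (real ^ 'd) set).
       ennreal (c2 * (real n * ln (real n)) powr (- 1 / real CARD('d))) \<le> wasserstein_risk p n W \<mu> \<nu>"
    using log_rate_lower_bound[OF assms, where ?'d = 'd] unfolding c2_def by blast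
  \<comment> \<open>For n < n0 the constant itself is pushed below the one-cell bound. The
    \<open>max n0 1\<close> avoids \<open>0 powr\<close>, which is 0 and would make c
    vanish.\<close>
  define c where "c = min c2 (c1 * real (max n0 1) powr (- 1 / (2 * p)))"
  have c: "0 < c" using assms by (simp add: c_def c1_def c2_def)
  have "\<exists>\<mu>\<in>prob_measures_on unit_cube. \<exists>\<nu>\<in>prob_measures_on (unit_cube :: (real ^ 'd) set).
        ennreal (lower_rate c p CARD('d) n) \<le> wasserstein_risk p n W \<mu> \<nu>"
    if n: "2 \<le> n" for n W
  proof (cases "n0 \<le> n")
    case True
    have "lower_rate c p CARD('d) n \<le> c2 * (real n * ln (real n)) powr (- 1 / real CARD('d))"
      using False by (auto simp: lower_rate_def c_def intro!: mult_right_mono)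
    then show ?thesis using n0[OF True, of W] by (meson ennreal_leI order_trans)
  next
    case small: False
    \<comment> \<open>Since 2 ln 2 > 1, the base is at least 1 for all n >= 2, and the logarithmic
      rate is at most c.\<close>
    have "1 \<le> real n * ln (real n)"
    proof -
      have "ln 2 \<le> ln (real n)" using n by simp
      then have "2 * (1 / 2) \<le> real n * ln (real n)"
        using n ln2_ge_two_thirds by (intro mult_mono) linarith+
      then show ?thesis by simp
    qed
    then have "(real n * ln (real n)) powr (- 1 / real CARD('d)) \<le> 1"
      using powr_mono[of "- 1 / real CARD('d)" 0 "real n * ln (real n)"] by (auto split: if_splits)
    then have "lower_rate c p CARD('d) n \<le> c"
      using False c by (simp add: lower_rate_def mult_left_le)
    also have "\<dots> \<le> c1 * real (max n0 1) powr (- 1 / (2 * p))" by (simp add: c_def)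
    also have "\<dots> \<le> c1 * real n powr (- 1 / (2 * p))"
      using n small assms by (intro mult_left_mono powr_mono2') (auto simp: c1_def)
    finally have "lower_rate c p CARD('d) n \<le> c1 * real n powr (- 1 / (2 * p))" .
    then show ?thesis using small_rate_lower_bound[OF assms, of n W] n unfolding c1_def
      by (meson ennreal_leI order_trans one_le_numeral)
  qed
  then show ?thesis using c by (intro exI[of _ c]) auto
qed

end
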